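(* Let $1<p<\infty$ and $0<\kappa<1$. Let $V\ge0$ be locally integrable on $\mathbb H^n$, $V\not\equiv0$, with $V\in RH_s$ for some $s\geq Q/2$. Then for each fixed $N\in\mathbb N$, the maximal operator $\mathcal M_{\rho,N}$ is bounded on $L^{p,\kappa}_{\rho,\theta}(\mathbb H^n)$ for every $\theta$ with $0<\theta(N_0+1)\le N$.
   Context: The Heisenberg group $\mathbb H^n$ is $\mathbb C^n\times\mathbb R$ with multiplication $(z,t)\cdot(z',t')=(z+z',t+t'+2\,\mathrm{Im}(z\cdot\overline{z'}))$, $z\cdot\overline{z'}=\sum_j z_j\overline{z_j'}$; inverse $(z,t)^{-1}=(-z,-t)$; Haar measure is Lebesgue measure, $|E|$ the measure. Homogeneous norm $|(z,t)|=(|z|^4+t^2)^{1/4}$, balls $B(u,r)=\{v:|u^{-1}v|<r\}$, $Q=2n+2$. $V\in RH_s$ means $\big(\frac1{|B|}\int_B V^s\big)^{1/s}\le C\frac1{|B|}\int_B V$ for all balls. Critical radius: $\rho(u)=\sup\{r>0: r^{2-Q}\int_{B(u,r)}V\le 1\}\in(0,\infty)$. $N_0>0$ (together with $C_0\ge1$) denotes constants, which exist under these hypotheses, such that for all $u,v\in\mathbb H^n$: $C_0^{-1}[1+|v^{-1}u|/\rho(u)]^{-N_0}\le\rho(v)/\rho(u)\le C_0[1+|v^{-1}u|/\rho(u)]^{N_0/(N_0+1)}$. For $N\in\mathbb N$, $\mathcal M_{\rho,N}f(u)=\sup_{r>0}[1+r/\rho(u)]^{-N}\frac1{|B(u,r)|}\int_{B(u,r)}|f(v)|\,dv$.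 For $\theta>0$, $L^{p,\kappa}_{\rho,\theta}(\mathbb H^n)$ is the set of $f\in L^p_{\rm loc}$ with $\|f\|_{L^{p,\kappa}_{\rho,\theta}}:=\sup_{B=B(u_0,r)}[1+r/\rho(u_0)]^{-\theta}\big(|B|^{-\kappa}\int_B|f|^p\big)^{1/p}<\infty$. *)

theory Defs
  imports "HOL-Analysis.Analysis"
begin

type_synonym 'n heis = "(complex ^ 'n) \<times> real"

definition hmul :: "'n::finite heis \<Rightarrow> 'n heis \<Rightarrow> 'n heis" where
  "hmul u v = (fst u + fst v,
     snd u + snd v + 2 * Im (\<Sum>j\<in>UNIV. (fst u $ j) * cnj (fst v $ j)))"

definition hinv :: "'n::finite heis \<Rightarrow> 'n heis" where
  "hinv u = (- fst u, - snd u)"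

definition hnorm :: "'n::finite heis \<Rightarrow> real" where
  "hnorm u = (norm (fst u) ^ 4 + (snd u)\<^sup>2) powr (1/4)"

definition hball :: "'n::finite heis \<Rightarrow> real \<Rightarrow> 'n heis set" where
  "hball u r = {v. hnorm (hmul (hinv u) v) < r}"

text \<open>Haar measure = Lebesgue measure.\<close>
definition hvol :: "'n::finite heis set \<Rightarrow> real" where
  "hvol E = measure lebesgue E"

definition Qdim :: "'n::finite itself \<Rightarrow> real" where
  "Qdim _ = 2 * real CARD('n) + 2"

definition loc_integrable :: "('n::finite heis \<Rightarrow> real) \<Rightarrow> bool" where
  "loc_integrable V \<longleftrightarrow> (\<forall>u r. set_integrable lebesgue (hball u r) V)"

definition RH :: "real \<Rightarrow> ('n::finite heis \<Rightarrow> real) \<Rightarrow> bool" where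
  "RH s V \<longleftrightarrow> (\<exists>C. \<forall>u r. r > 0 \<longrightarrow>
     set_integrable lebesgue (hball u r) (\<lambda>v. V v powr s) \<and>
     ((1 / hvol (hball u r)) * (LINT v:hball u r|lebesgue. V v powr s)) powr (1 / s)
       \<le> C * ((1 / hvol (hball u r)) * (LINT v:hball u r|lebesgue. V v)))"

definition crit_rad :: "('n::finite heis \<Rightarrow> real) \<Rightarrow> 'n heis \<Rightarrow> real" where
  "crit_rad V u = Sup {r. 0 < r \<and>
     r powr (2 - Qdim TYPE('n)) * (LINT v:hball u r|lebesgue. V v) \<le> 1}"

definition Mrho :: "('n::finite heis \<Rightarrow> real) \<Rightarrow> nat \<Rightarrow> ('n heis \<Rightarrow> real) \<Rightarrow> 'n heis \<Rightarrow> ereal" where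
  "Mrho V N f u = (SUP r\<in>{0<..}. ereal ((1 + r / crit_rad V u) powr (- real N)
       * ((1 / hvol (hball u r)) * (LINT v:hball u r|lebesgue. \<bar>f v\<bar>))))"

text \<open>g lies in L^{p,kappa}_{rho,theta} with norm at most K.\<close>
definition morrey_le :: "('n::finite heis \<Rightarrow> real) \<Rightarrow> real \<Rightarrow> real \<Rightarrow> real \<Rightarrow> real
    \<Rightarrow> ('n heis \<Rightarrow> real) \<Rightarrow> bool" where
  "morrey_le V p \<kappa> \<theta> K g \<longleftrightarrow> g \<in> borel_measurable lebesgue \<and>
     (\<forall>u r. r > 0 \<longrightarrow> set_integrable lebesgue (hball u r) (\<lambda>v. \<bar>g v\<bar> powr p) \<and>
        (1 + r / crit_rad V u) powr (- \<theta>) *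
          (hvol (hball u r) powr (- \<kappa>) * (LINT v:hball u r|lebesgue. \<bar>g v\<bar> powr p)) powr (1 / p)
        \<le> K)"

end

theory Submission
  imports Defs
begin

text \<open>Fix a ball B(u0, r) and u in it. Averages of |f| over B(u, t) with t > r are bounded by the Morrey
  norm over B(u, t) itself: since \<theta> \<le> N, the weight of the maximal operator absorbs the growth of
  the norm, and the remaining factor |B(u, t)| to the power (\<kappa> - 1) / p decreases in t. Averages with
  t \<le> r only see f on B(u0, 2r), where the Hardy--Littlewood maximal theorem applies. The
  comparability of critical radii makes \<rho> positive.\<close>

section \<open>The Koranyi metric\<close>

text \<open>Taking the Morrey condition on B(u, t), and not on a larger ball around u0, puts rho(u)
  into both weights: they combine to a power of 1 + t/rho(u), with no passage between rho(u) and
  rho(u0). The far averages are thus bounded by a constant on B(u0, r), and the p-th power of this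
  constant times |B(u0, r)| is a multiple of |B(u0, r)| to the power \<kappa>, which is the Morrey
  growth again. The conclusion also asserts measurability of the maximal function, and this shapes
  much of the proof: the supremum runs over uncountably many radii, and its weight contains rho,
  which is itself a supremum. Left-continuity in the radius lets rational radii decide both. Since
  the integrals refer to the completed measure, functions are first replaced by Borel functions
  equal to them almost everywhere, so that Tonelli applies. Finally \<open>enn2real\<close> and
  \<open>real_of_ereal\<close> send infinity to 0, so a bound on their values says nothing where the
  maximal function is infinite; finiteness almost everywhere is proved alongside the bounds.\<close>

abbreviation hdist :: "'n::finite heis \<Rightarrow> 'n heis \<Rightarrow> real" where
  "hdist u v \<equiv> hnorm (hmul (hinv u) v)"

definition cdot :: "complex ^ 'n::finite \<Rightarrow> complex ^ 'n \<Rightarrow> complex" where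
  "cdot z w = (\<Sum>j\<in>UNIV. z $ j * cnj (w $ j))"

lemma hmul_cdot: "hmul u v = (fst u + fst v, snd u + snd v + 2 * Im (cdot (fst u) (fst v)))"
  by (simp add: hmul_def cdot_def)

lemma cdot_minus_left: "cdot (- x) y = - cdot x y"
  by (simp add: cdot_def sum_negf)

lemma cdot_diff_left: "cdot (x - y) z = cdot x z - cdot y z"
  by (simp add: cdot_def sum_subtractf algebra_simps)

lemma cdot_diff_right: "cdot x (y - z) = cdot x y - cdot x z"
  by (simp add: cdot_def sum_subtractf algebra_simps)

lemma cdot_self: "cdot x x = of_real ((norm x)\<^sup>2)"
proof -
  have "(norm x)\<^sup>2 = (\<Sum>j\<in>UNIV. (norm (x $ j))\<^sup>2)"
    by (simp add: norm_vec_def L2_set_def sum_nonneg)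
  then show ?thesis
    unfolding cdot_def by (simp only: of_real_sum complex_norm_square)
qed

lemma Im_cdot_swap: "Im (cdot y x) = - Im (cdot x y)"
  by (simp add: cdot_def Im_sum sum_negf[symmetric] algebra_simps)

lemma Re_cdot: "Re (cdot x y) = inner x y"
  by (simp add: cdot_def inner_vec_def Re_sum inner_complex_def)

lemma norm_cdot_le: "norm (cdot x y) \<le> norm x * norm y"
proof -
  have "norm (cdot x y) \<le> (\<Sum>j\<in>UNIV. norm (x $ j) * norm (y $ j))"
    unfolding cdot_def by (rule order_trans[OF norm_sum]) (simp add: norm_mult)
  also have "\<dots> \<le> norm x * norm y"
    using L2_set_mult_ineq[of "\<lambda>j. norm (x $ j)" "\<lambda>j. norm (y $ j)" UNIV]
    by (simp add: norm_vec_def)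
  finally show ?thesis .
qed

lemma hnorm_eq_sqrt: "hnorm u = sqrt (sqrt (norm (fst u) ^ 4 + (snd u)\<^sup>2))"
proof -
  let ?a = "norm (fst u) ^ 4 + (snd u)\<^sup>2"
  have "?a powr (1/4) = (?a powr (1/2)) powr (1/2)"
    by (simp add: powr_powr)
  also have "\<dots> = sqrt (sqrt ?a)"
    by (simp add: powr_half_sqrt)
  finally show ?thesis
    by (simp add: hnorm_def)
qed

lemma hnorm_nonneg [simp]: "0 \<le> hnorm u"
  by (simp add: hnorm_eq_sqrt)

text \<open>Writing the gauge through the complex number |z|^2 + i t reduces its subadditivity to
  the triangle inequality for the modulus.\<close>

lemma hnorm_square: "(hnorm u)\<^sup>2 = norm (Complex ((norm (fst u))\<^sup>2) (snd u))"
  by (simp add: hnorm_eq_sqrt complex_norm power_mult[symmetric])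

lemma hnorm_less_iff: "hnorm u < r \<longleftrightarrow> 0 < r \<and> norm (fst u) ^ 4 + (snd u)\<^sup>2 < r ^ 4"
proof (cases "0 < r")
  case True
  have "hnorm u < r \<longleftrightarrow> sqrt (norm (fst u) ^ 4 + (snd u)\<^sup>2) < r\<^sup>2"
    using True real_sqrt_less_iff[of "sqrt (norm (fst u) ^ 4 + (snd u)\<^sup>2)" "r\<^sup>2"]
    by (simp add: hnorm_eq_sqrt)
  also have "\<dots> \<longleftrightarrow> norm (fst u) ^ 4 + (snd u)\<^sup>2 < (r\<^sup>2)\<^sup>2"
    using real_sqrt_less_iff[of "norm (fst u) ^ 4 + (snd u)\<^sup>2" "(r\<^sup>2)\<^sup>2"] by (simp only: real_sqrt_abs) simp
  finally show ?thesis
    using True by (simp add: power_mult[symmetric])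
next
  case False
  then show ?thesis
    using hnorm_nonneg[of u] by linarith
qed

text \<open>The complex number |z|^2 + i t of a product is the sum of those of the factors plus
  twice the Hermitian pairing: the real part is polarisation, the imaginary part is the group law.
  Cauchy-Schwarz for the pairing then completes the square (\<open>hnorm u\<close> +
  \<open>hnorm v\<close>)^2.\<close>

lemma hnorm_hmul_le: "hnorm (hmul u v) \<le> hnorm u + hnorm v"
proof -
  let ?c = "\<lambda>u :: 'a heis. Complex ((norm (fst u))\<^sup>2) (snd u)"
  let ?x = "fst u" and ?y = "fst v"
  have "(norm (?x + ?y))\<^sup>2 = (norm ?x)\<^sup>2 + (norm ?y)\<^sup>2 + 2 * Re (cdot ?x ?y)"
    by (simp add: Re_cdot power2_norm_eq_inner inner_add_left inner_add_right inner_commute)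
  then have "?c (hmul u v) = ?c u + ?c v + 2 * cdot ?x ?y"
    by (simp add: hmul_cdot complex_eq_iff)
  then have "(hnorm (hmul u v))\<^sup>2 \<le> norm (?c u + ?c v) + norm (2 * cdot ?x ?y)"
    using norm_triangle_ineq[of "?c u + ?c v" "2 * cdot ?x ?y"] by (simp only: hnorm_square)
  also have "\<dots> \<le> (hnorm u)\<^sup>2 + (hnorm v)\<^sup>2 + 2 * (norm ?x * norm ?y)"
    using norm_triangle_ineq[of "?c u" "?c v"] norm_cdot_le[of ?x ?y]
    by (simp add: hnorm_square norm_mult)
  also have "\<dots> \<le> (hnorm u)\<^sup>2 + (hnorm v)\<^sup>2 + 2 * (hnorm u * hnorm v)"
  proof -
    have "norm (fst w) \<le> hnorm w" for w :: "'a heis"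
    proof (rule power2_le_imp_le)
      show "(norm (fst w))\<^sup>2 \<le> (hnorm w)\<^sup>2"
        using abs_Re_le_cmod[of "?c w"] unfolding hnorm_square by simp
    qed simp
    then show ?thesis
      by (intro add_left_mono mult_left_mono mult_mono) simp_all
  qed
  finally have "(hnorm (hmul u v))\<^sup>2 \<le> (hnorm u + hnorm v)\<^sup>2"
    by (simp add: power2_sum)
  then show ?thesis
    by (rule power2_le_imp_le) simp
qed

lemma hnorm_hinv: "hnorm (hinv u) = hnorm u"
  by (simp add: hnorm_def hinv_def)

lemma hdist_commute: "hdist u v = hdist v u"
proof -
  have "hmul (hinv u) v = hinv (hmul (hinv v) u)"
    by (simp add: hmul_cdot hinv_def cdot_minus_left Im_cdot_swap[of "fst v" "fst u"])
  then show ?thesis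
    by (simp add: hnorm_hinv)
qed

lemma hdist_self [simp]: "hdist u u = 0"
  by (simp add: hmul_cdot hinv_def cdot_minus_left cdot_self hnorm_def)

lemma hdist_triangle: "hdist u w \<le> hdist u v + hdist v w"
proof -
  have "hmul (hinv u) w = hmul (hmul (hinv u) v) (hmul (hinv v) w)"
    using Im_cdot_swap[of "fst v" "fst u"]
    by (simp add: hmul_cdot hinv_def cdot_minus_left cdot_diff_left cdot_diff_right cdot_self)
  then show ?thesis
    using hnorm_hmul_le by metis
qed

text \<open>A move by a^2 in the central coordinate alone covers distance a, because the gauge takes
  a square root there. This will produce the point that excludes a negative critical radius.\<close>

lemma hdist_surj:
  assumes "0 \<le> a"
  shows "\<exists>v. hdist v u = a"
proof
  have "sqrt (a ^ 4) = a\<^sup>2"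
    by (rule real_sqrt_unique) (simp_all add: power_mult[symmetric])
  then show "hdist (fst u, snd u + a\<^sup>2) u = a"
    using assms by (simp add: hmul_cdot hinv_def cdot_minus_left cdot_self hnorm_eq_sqrt)
qed

lemma mem_hball: "v \<in> hball u r \<longleftrightarrow> hdist u v < r"
  by (simp add: hball_def)

lemma hball_mono: "r \<le> s \<Longrightarrow> hball u r \<subseteq> hball u s"
  by (auto simp: mem_hball)

lemma hball_subset:
  assumes "hdist u v + s \<le> r"
  shows "hball v s \<subseteq> hball u r"
proof
  fix w assume "w \<in> hball v s"
  then show "w \<in> hball u r"
    using hdist_triangle[of u w v] assms by (simp add: mem_hball)
qed

text \<open>Openness is stated jointly in both points: sections of this set are balls, and the set
  itself gives the product measurability behind integrals over balls with a moving centre.\<close>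

lemma open_hdist_less: "open {x :: 'n::finite heis \<times> 'n heis. hdist (fst x) (snd x) < r}"
proof -
  have "continuous_on UNIV (\<lambda>x :: 'n heis \<times> 'n heis. hdist (fst x) (snd x))"
    unfolding hnorm_eq_sqrt hmul_def hinv_def fst_conv snd_conv
    by (intro continuous_intros)
  then show ?thesis
    by (intro open_Collect_less) auto
qed

lemma open_hball: "open (hball u r)"
proof -
  have "continuous_on UNIV (Pair u :: 'a heis \<Rightarrow> _)"
    by (intro continuous_intros)
  then have "open (Pair u -` {x. hdist (fst x) (snd x) < r})"
    by (rule open_vimage[OF open_hdist_less])
  then show ?thesis
    by (simp add: hball_def vimage_def)
qed

lemma hball_borel [measurable]: "hball u r \<in> sets borel"
  by (simp add: open_hball borel_open)

section \<open>Volume of balls\<close>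

lemma nn_integral_lborel_affine:
  fixes t :: "'a::euclidean_space"
  assumes [measurable]: "f \<in> borel_measurable borel" and c: "c \<noteq> 0"
  shows "(\<integral>\<^sup>+x. f x \<partial>lborel) = ennreal (\<bar>c\<bar> ^ DIM('a)) * (\<integral>\<^sup>+x. f (t + c *\<^sub>R x) \<partial>lborel)"
  by (subst lborel_affine[OF c, of t]) (simp add: nn_integral_density nn_integral_distr nn_integral_cmult)

text \<open>This is the homogeneous dimension Q = 2n + 2 as a natural number: dilations scale z by r
  and the central coordinate, counted twice, by r^2.\<close>

abbreviation hdim :: "'n::finite itself \<Rightarrow> nat" where
  "hdim _ \<equiv> DIM(complex ^ 'n) + 2"

text \<open>By Tonelli the volume is the integral over z of the lengths of the slices in t. Left
  translation moves z and shifts t by an amount that depends on z but not on t, so no slice changes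
  its length; the dilation (r z, r^2 t) then gives the power of r.\<close>

lemma emeasure_hball:
  fixes u :: "'n::finite heis"
  assumes r: "0 < r"
  shows "emeasure lborel (hball u r) = ennreal (r ^ hdim TYPE('n)) * emeasure lborel (hball (0 :: 'n heis) 1)"
proof -
  define A :: "real \<Rightarrow> 'n heis set" where "A s = {x. norm (fst x) ^ 4 + (snd x)\<^sup>2 < s ^ 4}" for s
  have A [measurable]: "A s \<in> sets borel" for s
    unfolding A_def by (intro borel_open open_Collect_less continuous_intros)
  have A' [measurable]: "A s \<in> sets (borel \<Otimes>\<^sub>M borel)" for s
    unfolding borel_prod by (rule A)
  define S where "S s z = (\<integral>\<^sup>+t. indicator (A s) (z, t) \<partial>lborel)" for s :: real and z :: "complex ^ 'n"
  have S [measurable]: "S s \<in> borel_measurable borel" for s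
    unfolding S_def by measurable
  have slices: "emeasure lborel (hball v s) = (\<integral>\<^sup>+z. S s z \<partial>lborel)" if s: "0 < s" for v :: "'n heis" and s
  proof -
    have "emeasure lborel (hball v s) = (\<integral>\<^sup>+x. indicator (hball v s) x \<partial>(lborel \<Otimes>\<^sub>M lborel))"
      by (simp add: lborel_prod)
    also have "\<dots> = (\<integral>\<^sup>+z. \<integral>\<^sup>+t. indicator (hball v s) (z, t) \<partial>lborel \<partial>lborel)"
      by (rule lborel.nn_integral_fst[symmetric]) (simp add: lborel_prod)
    also have "\<dots> = (\<integral>\<^sup>+z. S s (z - fst v) \<partial>lborel)"
    proof (rule nn_integral_cong)
      fix z :: "complex ^ 'n"
      define a where "a = snd (hmul (hinv v) (z, 0))"
      have "indicator (hball v s) (z, t) = (indicator (A s) (z - fst v, a + 1 * t) :: ennreal)" for t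
      proof -
        have "hmul (hinv v) (z, t) = (z - fst v, a + t)"
          by (simp add: a_def hmul_def hinv_def)
        then show ?thesis
          using s by (simp add: hball_def A_def hnorm_less_iff indicator_def)
      qed
      then have "(\<integral>\<^sup>+t. indicator (hball v s) (z, t) \<partial>lborel)
          = (\<integral>\<^sup>+t. indicator (A s) (z - fst v, a + 1 * t) \<partial>lborel)"
        by simp
      also have "\<dots> = S s (z - fst v)"
        unfolding S_def
        using nn_integral_real_affine[of "\<lambda>t. indicator (A s) (z - fst v, t)" 1 a] by simp
      finally show "(\<integral>\<^sup>+t. indicator (hball v s) (z, t) \<partial>lborel) = S s (z - fst v)" .
    qed
    also have "\<dots> = (\<integral>\<^sup>+z. S s z \<partial>lborel)"
      using nn_integral_lborel_affine[of "S s" 1 "- fst v"] by simp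
    finally show ?thesis .
  qed
  have scale: "S r (r *\<^sub>R z) = ennreal (r\<^sup>2) * S 1 z" for z
  proof -
    have "norm (r *\<^sub>R z) ^ 4 + (r\<^sup>2 * t)\<^sup>2 < r ^ 4 \<longleftrightarrow> norm z ^ 4 + t\<^sup>2 < 1 ^ 4" for t
    proof -
      have "norm (r *\<^sub>R z) ^ 4 + (r\<^sup>2 * t)\<^sup>2 = r ^ 4 * (norm z ^ 4 + t\<^sup>2)"
        using r by (simp add: power_mult_distrib distrib_left power_mult[symmetric])
      then show ?thesis
        using r by simp
    qed
    then have "indicator (A r) (r *\<^sub>R z, r\<^sup>2 * t) = (indicator (A 1) (z, t) :: ennreal)" for t
      by (simp add: A_def indicator_def)
    then show ?thesis
      unfolding S_def
      using r nn_integral_real_affine[of "\<lambda>t. indicator (A r) (r *\<^sub>R z, t)" "r\<^sup>2" 0] by simp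
  qed
  have "emeasure lborel (hball u r) = ennreal (r ^ DIM(complex ^ 'n)) * (\<integral>\<^sup>+z. S r (r *\<^sub>R z) \<partial>lborel)"
    using nn_integral_lborel_affine[of "S r" r 0] r by (simp add: slices)
  also have "\<dots> = ennreal (r ^ DIM(complex ^ 'n)) * (ennreal (r\<^sup>2) * (\<integral>\<^sup>+z. S 1 z \<partial>lborel))"
    by (simp add: scale nn_integral_cmult)
  also have "\<dots> = ennreal (r ^ hdim TYPE('n)) * emeasure lborel (hball (0 :: 'n heis) 1)"
    using r by (simp only: slices zero_less_one power_add ennreal_mult' mult.assoc zero_le_power less_imp_le)
  finally show ?thesis .
qed

lemma emeasure_hball_pos:
  assumes "0 < r"
  shows "0 < emeasure lborel (hball u r)"
proof -
  have "u \<in> hball u r"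
    using assms by (simp add: mem_hball)
  then have "\<not> negligible (hball u r)"
    using open_not_negligible[OF open_hball] by blast
  then show ?thesis
    by (simp add: negligible_iff_null_sets null_sets_def zero_less_iff_neq_zero)
qed

lemma emeasure_hball_finite:
  "emeasure lborel (hball (u :: 'n::finite heis) r) < \<infinity>"
proof (cases "0 < r")
  case True
  have "hball (0 :: 'n heis) 1 \<subseteq> cball 0 1 \<times> cball 0 1"
  proof
    fix v :: "'n heis" assume "v \<in> hball 0 1"
    then have *: "norm (fst v) ^ 4 + (snd v)\<^sup>2 < 1"
      by (simp add: hball_def hmul_def hinv_def hnorm_less_iff)
    then have "norm (fst v) ^ 4 \<le> 1 ^ 4"
      using zero_le_power2[of "snd v"] unfolding power_one by linarith
    then have 1: "norm (fst v) \<le> 1"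
      using power_mono_iff[of "norm (fst v)" 1 4] by simp
    have "0 \<le> norm (fst v) ^ 4"
      by simp
    then have "(snd v)\<^sup>2 \<le> 1"
      using * by linarith
    then have "\<bar>snd v\<bar> \<le> 1"
      by (simp add: abs_square_le_1)
    then show "v \<in> cball 0 1 \<times> cball 0 1"
      using 1 by (simp add: mem_Times_iff)
  qed
  then have "bounded (hball (0 :: 'n heis) 1)"
    by (rule bounded_subset[rotated]) (intro bounded_Times bounded_cball)
  then show ?thesis
    using emeasure_bounded_finite[of "hball (0 :: 'n heis) 1"]
    by (simp add: emeasure_hball[OF True] ennreal_mult_less_top)
next
  case False
  have "hball u r = {}"
    using False order_le_less_trans[OF hnorm_nonneg] unfolding hball_def by blast
  then show ?thesis
    by simp
qed

lemma emeasure_hball_triple: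
  fixes u :: "'n::finite heis"
  assumes "0 < r"
  shows "emeasure lborel (hball u (3 * r)) = ennreal (3 ^ hdim TYPE('n)) * emeasure lborel (hball u r)"
proof -
  have "0 < 3 * r"
    using assms by simp
  from emeasure_hball[OF this, of u] emeasure_hball[OF assms, of u] show ?thesis
    by (simp only: power_mult_distrib ennreal_mult' mult.assoc zero_le_power zero_le_numeral)
qed

lemma hvol_eq: "hvol (hball u r) = enn2real (emeasure lborel (hball u r))"
  by (simp add: hvol_def measure_def)

lemma ennreal_hvol: "ennreal (hvol (hball u r)) = emeasure lborel (hball u r)"
  using emeasure_hball_finite[of u r] by (simp add: hvol_eq)

lemma hvol_scale:
  fixes u :: "'n::finite heis"
  assumes "0 < r"
  shows "hvol (hball u r) = r ^ hdim TYPE('n) * hvol (hball (0 :: 'n heis) 1)"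
  using emeasure_hball[OF assms, of u] assms by (simp add: hvol_eq enn2real_mult)

lemma hvol_pos: "0 < r \<Longrightarrow> 0 < hvol (hball u r)"
  using emeasure_hball_pos[of r u] emeasure_hball_finite[of u r]
  by (simp add: hvol_eq enn2real_positive_iff)

lemma hvol_mono:
  fixes u v :: "'n::finite heis"
  assumes "0 < r" "r \<le> t"
  shows "hvol (hball u r) \<le> hvol (hball v t)"
proof -
  have "0 < t"
    using assms by linarith
  then show ?thesis
    using assms hvol_pos[of 1 "0 :: 'n heis"]
    unfolding hvol_scale[OF assms(1), of u] hvol_scale[OF \<open>0 < t\<close>, of v]
    by (intro mult_right_mono power_mono) simp_all
qed

section \<open>The Hardy--Littlewood maximal theorem\<close>

text \<open>Greedy selection: keep a ball of largest radius, drop every ball that meets it, and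
  recurse on the rest. A dropped ball has no larger radius than the kept one, so the triangle
  inequality places it inside the tripled ball.\<close>

lemma vitali_finite:
  fixes c :: "'i \<Rightarrow> 'n::finite heis"
  assumes "finite I" "\<forall>i\<in>I. 0 < r i"
  shows "\<exists>J\<subseteq>I. disjoint_family_on (\<lambda>i. hball (c i) (r i)) J \<and>
           (\<Union>i\<in>I. hball (c i) (r i)) \<subseteq> (\<Union>i\<in>J. hball (c i) (3 * r i))"
  using assms
proof (induction I rule: finite_psubset_induct)
  case (psubset I)
  let ?B = "\<lambda>i. hball (c i) (r i)"
  show ?case
  proof (cases "I = {}")
    case False
    then have "Max (r ` I) \<in> r ` I"
      using psubset.hyps by (intro Max_in) auto
    then obtain m where m: "m \<in> I" "r m = Max (r ` I)"
      by (metis imageE)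
    then have max: "r i \<le> r m" if "i \<in> I" for i
      using psubset.hyps that by simp
    define I' where "I' = {i \<in> I. ?B i \<inter> ?B m = {}}"
    have "c m \<in> ?B m"
      using psubset.prems m(1) by (simp add: mem_hball)
    then have "m \<notin> I'"
      unfolding I'_def by blast
    then have "I' \<subset> I"
      using m(1) unfolding I'_def by blast
    have "\<forall>i\<in>I'. 0 < r i"
      using psubset.prems by (simp add: I'_def)
    from psubset.IH[OF \<open>I' \<subset> I\<close> this] obtain J where J: "J \<subseteq> I'" "disjoint_family_on ?B J"
      "(\<Union>i\<in>I'. ?B i) \<subseteq> (\<Union>i\<in>J. hball (c i) (3 * r i))"
      by (elim exE conjE) (rule that)
    have triple: "?B i \<subseteq> hball (c m) (3 * r m)" if i: "i \<in> I" "i \<notin> I'" for i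
    proof (rule hball_subset)
      obtain v where v: "hdist (c i) v < r i" "hdist (c m) v < r m"
        using i by (auto simp: I'_def mem_hball)
      have "hdist (c m) (c i) \<le> hdist (c m) v + hdist (c i) v"
        using hdist_triangle[of "c m" "c i" v] hdist_commute[of v "c i"] by simp
      then show "hdist (c m) (c i) + r i \<le> 3 * r m"
        using v max[OF i(1)] by linarith
    qed
    have "disjoint_family_on ?B (insert m J)"
      using J(1,2) unfolding disjoint_family_on_def I'_def by blast
    moreover have "(\<Union>i\<in>I. ?B i) \<subseteq> (\<Union>i\<in>insert m J. hball (c i) (3 * r i))"
      using J(3) triple by blast
    moreover have "insert m J \<subseteq> I"
      using J(1) m by (auto simp: I'_def)
    ultimately show ?thesis
      by blast
  qed (simp add: disjoint_family_on_def)
qed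

definition havg :: "('n::finite heis \<Rightarrow> ennreal) \<Rightarrow> 'n heis \<Rightarrow> real \<Rightarrow> ennreal" where
  "havg g u r = (\<integral>\<^sup>+v\<in>hball u r. g v \<partial>lborel) / emeasure lborel (hball u r)"

text \<open>Restricting to rational radii keeps the supremum countable, hence measurable.\<close>

definition HL :: "('n::finite heis \<Rightarrow> ennreal) \<Rightarrow> 'n heis \<Rightarrow> ennreal" where
  "HL g u = (SUP r\<in>{r\<in>\<rat>. 0 < r}. havg g u r)"

lemma borel_measurable_hball_integral [measurable]:
  fixes g :: "'n::finite heis \<Rightarrow> ennreal"
  assumes [measurable]: "g \<in> borel_measurable borel"
  shows "(\<lambda>u. \<integral>\<^sup>+v\<in>hball u r. g v \<partial>lborel) \<in> borel_measurable borel"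
proof -
  have "{x :: 'n heis \<times> 'n heis. hdist (fst x) (snd x) < r} \<in> sets (borel \<Otimes>\<^sub>M borel)"
    unfolding borel_prod by (intro borel_open open_hdist_less)
  note [measurable] = this
  have "(\<lambda>u. \<integral>\<^sup>+v\<in>hball u r. g v \<partial>lborel) =
      (\<lambda>u. \<integral>\<^sup>+v. g v * indicator {x. hdist (fst x) (snd x) < r} (u, v) \<partial>lborel)"
    by (auto simp: hball_def indicator_def intro!: nn_integral_cong)
  also have "\<dots> \<in> borel_measurable borel"
    by measurable
  finally show ?thesis .
qed

lemma borel_measurable_emeasure_hball [measurable]:
  "(\<lambda>u :: 'n::finite heis. emeasure lborel (hball u r)) \<in> borel_measurable borel"
proof -
  have "(\<integral>\<^sup>+v\<in>hball u r. 1 \<partial>lborel) = emeasure lborel (hball u r)" for u :: "'n heis"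
    unfolding mult_1 by (rule nn_integral_indicator) simp
  with borel_measurable_hball_integral[of "\<lambda>_ :: 'n heis. 1" r] show ?thesis
    by (simp only: borel_measurable_const)
qed

lemma countable_pos_rats: "countable {r :: real. r \<in> \<rat> \<and> 0 < r}"
  by (rule countable_subset[OF _ countable_rat]) blast

lemma borel_measurable_HL [measurable]:
  assumes [measurable]: "g \<in> borel_measurable borel"
  shows "HL g \<in> borel_measurable borel"
proof -
  have [measurable]: "(\<lambda>u. havg g u r) \<in> borel_measurable borel" for r
    unfolding havg_def by measurable
  show ?thesis
    unfolding HL_def using countable_pos_rats by (intro borel_measurable_SUP) simp_all
qed

lemma havg_le_iff:
  assumes "0 < r"
  shows "havg g u r \<le> a \<longleftrightarrow> (\<integral>\<^sup>+v\<in>hball u r. g v \<partial>lborel) \<le> a * emeasure lborel (hball u r)"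
proof -
  let ?m = "emeasure lborel (hball u r)" and ?I = "\<integral>\<^sup>+v\<in>hball u r. g v \<partial>lborel"
  have m: "0 < ?m" "?m < top"
    using emeasure_hball_pos[OF assms, of u] emeasure_hball_finite[of u r] by simp_all
  have "havg g u r * ?m = ?I"
    using m by (simp add: havg_def ennreal_divide_times ennreal_times_divide[symmetric] ennreal_divide_self)
  moreover have "havg g u r \<le> a" if "?I \<le> a * ?m"
    unfolding havg_def using m(1) that by (simp add: divide_le_posI_ennreal mult.commute)
  ultimately show ?thesis
    by (metis mult_right_mono zero_le)
qed

text \<open>Passing to tripled disjoint balls costs the factor 3^Q, and disjointness lets the
  integrals over the selected balls add up to at most the whole integral. The constant does not
  depend on the number of balls.\<close>

lemma finite_cover_weak:
  fixes g :: "'n::finite heis \<Rightarrow> ennreal" and c :: "'i \<Rightarrow> 'n heis"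
  assumes [measurable]: "g \<in> borel_measurable borel" and I: "finite I"
    and r: "\<forall>i\<in>I. 0 < r i"
    and le: "\<And>i. i \<in> I \<Longrightarrow> l * emeasure lborel (hball (c i) (r i)) \<le> (\<integral>\<^sup>+v\<in>hball (c i) (r i). g v \<partial>lborel)"
  shows "l * emeasure lborel (\<Union>i\<in>I. hball (c i) (r i)) \<le> ennreal (3 ^ hdim TYPE('n)) * (\<integral>\<^sup>+v. g v \<partial>lborel)"
proof -
  let ?B = "\<lambda>i. hball (c i) (r i)" and ?k = "ennreal (3 ^ hdim TYPE('n))"
  obtain J where J: "J \<subseteq> I" "disjoint_family_on ?B J"
      "(\<Union>i\<in>I. ?B i) \<subseteq> (\<Union>i\<in>J. hball (c i) (3 * r i))"
    using vitali_finite[OF I r, where c = c] by (elim exE conjE) (rule that)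
  have fin: "finite J"
    using J(1) I by (rule finite_subset)
  have "emeasure lborel (\<Union>i\<in>I. ?B i) \<le> emeasure lborel (\<Union>i\<in>J. hball (c i) (3 * r i))"
    using J(3) fin by (intro emeasure_mono) auto
  also have "\<dots> \<le> (\<Sum>i\<in>J. emeasure lborel (hball (c i) (3 * r i)))"
    using fin by (intro emeasure_subadditive_finite) auto
  also have "\<dots> = ?k * (\<Sum>i\<in>J. emeasure lborel (?B i))"
    unfolding sum_distrib_left using J(1) r by (intro sum.cong refl emeasure_hball_triple) auto
  finally have "l * emeasure lborel (\<Union>i\<in>I. ?B i) \<le> l * (?k * (\<Sum>i\<in>J. emeasure lborel (?B i)))"
    by (rule mult_left_mono) simp
  also have "\<dots> = ?k * (\<Sum>i\<in>J. l * emeasure lborel (?B i))"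
    by (simp only: sum_distrib_left mult.left_commute)
  also have "\<dots> \<le> ?k * (\<Sum>i\<in>J. \<integral>\<^sup>+v\<in>?B i. g v \<partial>lborel)"
    using J(1) le by (intro mult_left_mono sum_mono) auto
  also have "(\<Sum>i\<in>J. \<integral>\<^sup>+v\<in>?B i. g v \<partial>lborel) = (\<integral>\<^sup>+v. g v * indicator (\<Union>i\<in>J. ?B i) v \<partial>lborel)"
    unfolding indicator_UN_disjoint[OF fin J(2)] sum_distrib_left
    by (rule nn_integral_sum[symmetric]) measurable
  also have "?k * \<dots> \<le> ?k * (\<integral>\<^sup>+v. g v \<partial>lborel)"
    by (intro mult_left_mono nn_integral_mono) (auto simp: indicator_def)
  finally show ?thesis .
qed

text \<open>Every point of the superlevel set is the centre of a ball on which the average exceeds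
  \<open>l\<close>. Lindelof leaves countably many of these balls, and continuity of the measure
  along increasing finite unions reduces the claim to the finite covering bound.\<close>

lemma HL_weak_type:
  fixes g :: "'n::finite heis \<Rightarrow> ennreal"
  assumes [measurable]: "g \<in> borel_measurable borel"
  shows "l * emeasure lborel {u. l < HL g u} \<le> ennreal (3 ^ hdim TYPE('n)) * (\<integral>\<^sup>+v. g v \<partial>lborel)"
proof -
  define E where "E = {u. l < HL g u}"
  have "\<exists>r>0. l < havg g u r" if "u \<in> E" for u
    using that by (auto simp: E_def HL_def less_SUP_iff)
  then obtain r where r: "\<And>u. u \<in> E \<Longrightarrow> 0 < r u" "\<And>u. u \<in> E \<Longrightarrow> l < havg g u (r u)"
    by metis
  have le: "l * emeasure lborel (hball u (r u)) \<le> (\<integral>\<^sup>+v\<in>hball u (r u). g v \<partial>lborel)" if "u \<in> E" for u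
    using r[OF that] havg_le_iff[of "r u" g u l] by (meson linear not_less)
  let ?B = "\<lambda>u. hball u (r u)"
  obtain F where F: "F \<subseteq> ?B ` E" "countable F" "\<Union>F = \<Union>(?B ` E)"
  proof (rule Lindelof[of "?B ` E"])
    show "open S" if "S \<in> ?B ` E" for S
      using that open_hball by blast
  qed
  then obtain D where D: "D \<subseteq> E" "countable D" "F = ?B ` D"
    using countable_subset_image[of F ?B E] by blast
  have cover: "E \<subseteq> (\<Union>u\<in>D. ?B u)"
    using r(1) F(3) D(3) by (force simp: mem_hball)
  show ?thesis
  proof (cases "D = {}")
    case True
    then have "E = {}"
      using cover by simp
    then show ?thesis
      unfolding E_def[symmetric] by simp
  next
    case False
    define e where "e = from_nat_into D"
    have e: "range e = D"
      unfolding e_def by (rule range_from_nat_into[OF False D(2)])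
    define A where "A n = (\<Union>i\<in>{..<n::nat}. ?B (e i))" for n
    have "incseq A"
      unfolding A_def incseq_def by (intro allI impI UN_mono) auto
    moreover have "range A \<subseteq> sets lborel"
      by (auto simp: A_def)
    ultimately have "emeasure lborel (\<Union>n. A n) = (SUP n. emeasure lborel (A n))"
      by (simp only: SUP_emeasure_incseq)
    moreover have "E \<subseteq> (\<Union>n. A n)"
      using cover by (auto simp: A_def simp flip: e)
    then have "emeasure lborel E \<le> emeasure lborel (\<Union>n. A n)"
      by (intro emeasure_mono) (auto simp: A_def)
    ultimately have "l * emeasure lborel E \<le> (SUP n. l * emeasure lborel (A n))"
      by (simp add: mult_left_mono flip: SUP_mult_left_ennreal)
    also have "\<dots> \<le> ennreal (3 ^ hdim TYPE('n)) * (\<integral>\<^sup>+v. g v \<partial>lborel)"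
    proof (rule SUP_least)
      fix n
      have "e i \<in> E" for i
        using e D(1) by blast
      then show "l * emeasure lborel (A n) \<le> ennreal (3 ^ hdim TYPE('n)) * (\<integral>\<^sup>+v. g v \<partial>lborel)"
        unfolding A_def using r(1) le by (intro finite_cover_weak) simp_all
    qed
    finally show ?thesis
      by (simp add: E_def)
  qed
qed

text \<open>The infinite set lies in every superlevel set, so n times its measure stays bounded as n
  grows. This is what makes later bounds on \<open>enn2real (HL g u)\<close> meaningful.\<close>

lemma HL_finite_AE:
  fixes g :: "'n::finite heis \<Rightarrow> ennreal"
  assumes [measurable]: "g \<in> borel_measurable borel" and fin: "(\<integral>\<^sup>+v. g v \<partial>lborel) < \<infinity>"
  shows "AE u in lborel. HL g u < \<infinity>"
proof -
  let ?E = "{u. HL g u = \<infinity>}"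
  let ?K = "ennreal (3 ^ hdim TYPE('n)) * (\<integral>\<^sup>+v. g v \<partial>lborel)"
  have le: "of_nat n * emeasure lborel ?E \<le> ?K" for n :: nat
  proof -
    have "?E \<subseteq> {u. of_nat n < HL g u}"
      by (auto simp: of_nat_less_top)
    then have "of_nat n * emeasure lborel ?E \<le> of_nat n * emeasure lborel {u. of_nat n < HL g u}"
      by (intro mult_left_mono emeasure_mono) simp_all
    then show ?thesis
      using HL_weak_type[OF assms(1), of "of_nat n"] by (rule order_trans)
  qed
  have "?K < \<infinity>"
    using fin by (simp add: ennreal_mult_less_top)
  have "emeasure lborel ?E = 0"
  proof (rule ccontr)
    assume "emeasure lborel ?E \<noteq> 0"
    then have "(SUP n. of_nat n * emeasure lborel ?E) = \<infinity>"
      by (simp add: SUP_mult_right_ennreal[symmetric] ennreal_SUP_of_nat_eq_top ennreal_top_mult)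
    moreover have "(SUP n. of_nat n * emeasure lborel ?E) \<le> ?K"
      using le by (intro SUP_least)
    ultimately have "\<infinity> \<le> ?K"
      by (simp only:)
    then show False
      using \<open>?K < \<infinity>\<close> by (rule leD[THEN notE])
  qed
  then have "?E \<in> null_sets lborel"
    by (simp add: null_sets_def)
  from AE_not_in[OF this] show ?thesis
    by (simp add: less_top)
qed

section \<open>From weak type to strong type: truncation and the layer-cake formula\<close>

lemma nn_integral_powr:
  fixes a c :: real
  assumes "-1 < a" "0 \<le> c"
  shows "(\<integral>\<^sup>+x. ennreal (x powr a * indicator {0<..<c} x) \<partial>lborel) = ennreal (c powr (a + 1) / (a + 1))"
proof (rule nn_integral_has_integral_lborel)
  have "((\<lambda>x. x powr a) has_integral c powr (a + 1) / (a + 1)) {0<..<c}"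
    using has_integral_powr_from_0[OF assms] by (simp add: has_integral_Icc_iff_Ioo)
  moreover have "(\<lambda>x. x powr a * indicator {0<..<c} x) = (\<lambda>x. if x \<in> {0<..<c} then x powr a else 0)"
    by (auto simp: indicator_def)
  ultimately show "((\<lambda>x. x powr a * indicator {0<..<c} x) has_integral c powr (a + 1) / (a + 1)) UNIV"
    by (simp only: has_integral_restrict_UNIV)
qed simp_all

text \<open>The values of \<open>g\<close> that do not exceed \<open>a\<close> contribute at most
  \<open>a\<close> to any average.\<close>

lemma HL_le_truncate:
  fixes g :: "'n::finite heis \<Rightarrow> ennreal"
  assumes [measurable]: "g \<in> borel_measurable borel"
  shows "HL g u \<le> HL (\<lambda>x. g x * indicator {x. a < g x} x) u + a"
  unfolding HL_def
proof (rule SUP_least)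
  let ?g = "\<lambda>x. g x * indicator {x. a < g x} x"
  fix r :: real assume r: "r \<in> {r \<in> \<rat>. 0 < r}"
  let ?B = "hball u r"
  have "(\<integral>\<^sup>+v\<in>?B. g v \<partial>lborel) \<le> (\<integral>\<^sup>+v. ?g v * indicator ?B v + a * indicator ?B v \<partial>lborel)"
    by (intro nn_integral_mono) (auto simp: indicator_def)
  also have "\<dots> = (\<integral>\<^sup>+v\<in>?B. ?g v \<partial>lborel) + a * emeasure lborel ?B"
    by (subst nn_integral_add) (simp_all add: nn_integral_cmult)
  also have "(\<integral>\<^sup>+v\<in>?B. ?g v \<partial>lborel) \<le> havg ?g u r * emeasure lborel ?B"
    using r havg_le_iff[of r ?g u "havg ?g u r"] by simp
  finally have "havg g u r \<le> havg ?g u r + a"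
    using r by (simp add: havg_le_iff distrib_right add_right_mono)
  also have "havg ?g u r \<le> (SUP r\<in>{r \<in> \<rat>. 0 < r}. havg ?g u r)"
    using r by (rule SUP_upper)
  finally show "havg g u r \<le> (SUP r\<in>{r \<in> \<rat>. 0 < r}. havg ?g u r) + a"
    by (simp add: add_right_mono)
qed

text \<open>Half of the level is spent on the part of \<open>g\<close> bounded by l/2. The other
  half is the level at which the weak-type bound is applied to what remains, and this lives where g
  > l/2.\<close>

lemma HL_weak_type_truncated:
  fixes g :: "'n::finite heis \<Rightarrow> real"
  assumes [measurable]: "g \<in> borel_measurable borel" and nonneg: "\<And>x. 0 \<le> g x" and l: "0 < l"
  shows "emeasure lborel {u. l < enn2real (HL g u)}
    \<le> ennreal (2 / l * 3 ^ hdim TYPE('n)) * (\<integral>\<^sup>+x. ennreal (g x * indicator {x. l < 2 * g x} x) \<partial>lborel)"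
proof -
  define g' where "g' x = ennreal (g x * indicator {x. l < 2 * g x} x)" for x
  have [measurable]: "g' \<in> borel_measurable borel"
    unfolding g'_def by measurable
  have trunc: "HL g u \<le> HL g' u + ennreal (l / 2)" for u
  proof -
    have "g' = (\<lambda>x. ennreal (g x) * indicator {x. ennreal (l / 2) < ennreal (g x)} x)"
      using l nonneg by (auto simp: g'_def indicator_def ennreal_less_iff fun_eq_iff)
    then show ?thesis
      using HL_le_truncate[of "\<lambda>x. ennreal (g x)" u "ennreal (l / 2)"] by simp
  qed
  have sub: "{u. l < enn2real (HL g u)} \<subseteq> {u. ennreal (l / 2) < HL g' u}"
  proof safe
    fix z t assume a: "l < enn2real (HL g (z, t))"
    show "ennreal (l / 2) < HL g' (z, t)"
    proof (rule ccontr)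
      assume "\<not> ennreal (l / 2) < HL g' (z, t)"
      then have "HL g (z, t) \<le> ennreal (l / 2) + ennreal (l / 2)"
        using trunc[of "(z, t)"] by (meson add_right_mono not_less order_trans)
      also have "\<dots> = ennreal l"
        using l by (simp flip: ennreal_plus)
      finally have "enn2real (HL g (z, t)) \<le> l"
        using l by (simp add: enn2real_leI)
      then show False
        using a by simp
    qed
  qed
  have "emeasure lborel {u. l < enn2real (HL g u)} \<le> emeasure lborel {u. ennreal (l / 2) < HL g' u}"
    using sub by (intro emeasure_mono) simp_all
  also have "\<dots> = ennreal (2 / l) * (ennreal (l / 2) * emeasure lborel {u. ennreal (l / 2) < HL g' u})"
    using l by (simp flip: mult.assoc ennreal_mult)
  also have "\<dots> \<le> ennreal (2 / l) * (ennreal (3 ^ hdim TYPE('n)) * (\<integral>\<^sup>+x. g' x \<partial>lborel))"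
    by (intro mult_left_mono HL_weak_type) simp_all
  also have "\<dots> = ennreal (2 / l * 3 ^ hdim TYPE('n)) * (\<integral>\<^sup>+x. g' x \<partial>lborel)"
    using l by (simp only: mult.assoc[symmetric] ennreal_mult' zero_le_power zero_le_divide_iff zero_le_numeral less_imp_le simp_thms)
  finally show ?thesis
    by (simp only: g'_def)
qed

text \<open>Layer-cake formula, Tonelli, the truncated weak bound at each level, and Tonelli again.
  The constant collects 2 * 3^Q from the weak bound, p from the layer cake, and 2^(p-1)/(p-1) from
  integrating l^(p-2) over 0 < l < 2g, which converges at 0 because p > 1.\<close>

lemma HL_strong_type:
  fixes g :: "'n::finite heis \<Rightarrow> real"
  assumes [measurable]: "g \<in> borel_measurable borel" and nonneg: "\<And>x. 0 \<le> g x" and p: "1 < p"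
  shows "(\<integral>\<^sup>+u. ennreal (enn2real (HL g u) powr p) \<partial>lborel)
    \<le> ennreal (2 * 3 ^ hdim TYPE('n) * p * 2 powr (p - 1) / (p - 1)) * (\<integral>\<^sup>+x. ennreal (g x powr p) \<partial>lborel)"
proof -
  define h where "h u = enn2real (HL g u)" for u
  have [measurable]: "h \<in> borel_measurable borel"
    unfolding h_def by measurable
  have h: "0 \<le> h u" for u
    by (simp add: h_def)
  define k :: real where "k = 3 ^ hdim TYPE('n)"
  have k: "0 < k"
    by (simp add: k_def)
  \<comment> \<open>The region below the graph of \<open>f\<close> at positive levels: as one
    measurable subset of the product it justifies each exchange of integrals, with \<open>h\<close>
    in the first and twice \<open>g\<close> in the second.\<close>
  define S where "S = (\<lambda>f :: 'n heis \<Rightarrow> real. {x :: 'n heis \<times> real. 0 < snd x \<and> snd x < f (fst x)})"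
  have S: "S f \<in> sets (borel \<Otimes>\<^sub>M borel)" if [measurable]: "f \<in> borel_measurable borel" for f
  proof -
    have "{x \<in> space (borel \<Otimes>\<^sub>M borel). 0 < snd x \<and> snd x < f (fst x)} \<in> sets (borel \<Otimes>\<^sub>M borel)"
      by measurable
    then show ?thesis
      by (simp add: S_def space_pair_measure)
  qed
  have "(\<integral>\<^sup>+u. ennreal (h u powr p) \<partial>lborel)
      = (\<integral>\<^sup>+u. \<integral>\<^sup>+l. ennreal (p * l powr (p - 1)) * indicator (S h) (u, l) \<partial>lborel \<partial>lborel)"
  proof (rule nn_integral_cong)
    fix u
    have "(\<integral>\<^sup>+l. ennreal (p * l powr (p - 1)) * indicator (S h) (u, l) \<partial>lborel)
        = (\<integral>\<^sup>+l. ennreal p * ennreal (l powr (p - 1) * indicator {0<..<h u} l) \<partial>lborel)"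
      using p by (intro nn_integral_cong) (auto simp: S_def indicator_def ennreal_mult)
    also have "\<dots> = ennreal p * ennreal (h u powr p / p)"
      using nn_integral_powr[of "p - 1" "h u"] p h[of u] by (simp add: nn_integral_cmult)
    also have "\<dots> = ennreal (h u powr p)"
      using p by (simp flip: ennreal_mult)
    finally show "ennreal (h u powr p) = (\<integral>\<^sup>+l. ennreal (p * l powr (p - 1)) * indicator (S h) (u, l) \<partial>lborel)" ..
  qed
  also have "\<dots> = (\<integral>\<^sup>+l. \<integral>\<^sup>+u. ennreal (p * l powr (p - 1)) * indicator (S h) (u, l) \<partial>lborel \<partial>lborel)"
    using S[of h] by (intro lborel_pair.Fubini'[symmetric]) (simp add: split_beta)
  also have "\<dots> \<le> (\<integral>\<^sup>+l. \<integral>\<^sup>+x. ennreal (2 * k * p) * (ennreal (l powr (p - 2) * g x) * indicator (S (\<lambda>x. 2 * g x)) (x, l)) \<partial>lborel \<partial>lborel)"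
  proof (rule nn_integral_mono)
    fix l :: real
    show "(\<integral>\<^sup>+u. ennreal (p * l powr (p - 1)) * indicator (S h) (u, l) \<partial>lborel)
      \<le> (\<integral>\<^sup>+x. ennreal (2 * k * p) * (ennreal (l powr (p - 2) * g x) * indicator (S (\<lambda>x. 2 * g x)) (x, l)) \<partial>lborel)"
    proof (cases "0 < l")
      case True
      have "(\<integral>\<^sup>+u. ennreal (p * l powr (p - 1)) * indicator (S h) (u, l) \<partial>lborel)
          = (\<integral>\<^sup>+u. ennreal (p * l powr (p - 1)) * indicator {u. l < h u} u \<partial>lborel)"
        using True by (intro nn_integral_cong) (auto simp: S_def indicator_def)
      also have "\<dots> = ennreal (p * l powr (p - 1)) * emeasure lborel {u. l < h u}"
        by (rule nn_integral_cmult_indicator) simp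
      also have "\<dots> \<le> ennreal (p * l powr (p - 1)) *
          (ennreal (2 / l * k) * (\<integral>\<^sup>+x. ennreal (g x * indicator {x. l < 2 * g x} x) \<partial>lborel))"
        unfolding h_def k_def by (intro mult_left_mono HL_weak_type_truncated assms True) simp
      also have "\<dots> = ennreal (p * l powr (p - 1) * (2 / l * k)) * (\<integral>\<^sup>+x. ennreal (g x * indicator {x. l < 2 * g x} x) \<partial>lborel)"
        unfolding mult.assoc[symmetric] using p True k by (subst ennreal_mult[symmetric]) (simp_all add: mult.assoc)
      also have "p * l powr (p - 1) * (2 / l * k) = 2 * k * p * l powr (p - 2)"
        using True powr_diff[of l "p - 1" 1] by simp
      also have "ennreal \<dots> * (\<integral>\<^sup>+x. ennreal (g x * indicator {x. l < 2 * g x} x) \<partial>lborel)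
          = (\<integral>\<^sup>+x. ennreal (2 * k * p * l powr (p - 2)) * ennreal (g x * indicator {x. l < 2 * g x} x) \<partial>lborel)"
        by (rule nn_integral_cmult[symmetric]) measurable
      also have "\<dots> = (\<integral>\<^sup>+x. ennreal (2 * k * p) * (ennreal (l powr (p - 2) * g x) * indicator (S (\<lambda>x. 2 * g x)) (x, l)) \<partial>lborel)"
        using p k True nonneg by (intro nn_integral_cong) (auto simp: S_def indicator_def mult.assoc simp flip: ennreal_mult)
      finally show ?thesis
        by simp
    qed (simp add: S_def)
  qed
  also have "\<dots> = (\<integral>\<^sup>+x. \<integral>\<^sup>+l. ennreal (2 * k * p) * (ennreal (l powr (p - 2) * g x) * indicator (S (\<lambda>x. 2 * g x)) (x, l)) \<partial>lborel \<partial>lborel)"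
    using S[of "\<lambda>x. 2 * g x"] by (intro lborel_pair.Fubini') (simp add: split_beta)
  also have "\<dots> = (\<integral>\<^sup>+x. ennreal (2 * k * p * 2 powr (p - 1) / (p - 1)) * ennreal (g x powr p) \<partial>lborel)"
  proof (rule nn_integral_cong)
    fix x
    have "(\<integral>\<^sup>+l. ennreal (2 * k * p) * (ennreal (l powr (p - 2) * g x) * indicator (S (\<lambda>x. 2 * g x)) (x, l)) \<partial>lborel)
        = (\<integral>\<^sup>+l. ennreal (2 * k * p * g x) * ennreal (l powr (p - 2) * indicator {0<..<2 * g x} l) \<partial>lborel)"
      using p k nonneg[of x] by (intro nn_integral_cong) (auto simp: S_def indicator_def mult_ac simp flip: ennreal_mult)
    also have "\<dots> = ennreal (2 * k * p * g x) * ennreal ((2 * g x) powr (p - 1) / (p - 1))"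
      using nn_integral_powr[of "p - 2" "2 * g x"] p nonneg[of x] by (simp add: nn_integral_cmult)
    also have "\<dots> = ennreal (2 * k * p * g x * ((2 * g x) powr (p - 1) / (p - 1)))"
      using p k nonneg[of x] by (intro ennreal_mult[symmetric]) simp_all
    also have "2 * k * p * g x * ((2 * g x) powr (p - 1) / (p - 1)) = 2 * k * p * 2 powr (p - 1) / (p - 1) * (g x powr p)"
      using nonneg[of x] powr_mult_base[of "g x" "p - 1"] by (simp add: powr_mult)
    also have "ennreal \<dots> = ennreal (2 * k * p * 2 powr (p - 1) / (p - 1)) * ennreal (g x powr p)"
      using p k by (intro ennreal_mult) simp_all
    finally show "(\<integral>\<^sup>+l. ennreal (2 * k * p) * (ennreal (l powr (p - 2) * g x) * indicator (S (\<lambda>x. 2 * g x)) (x, l)) \<partial>lborel)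
        = ennreal (2 * k * p * 2 powr (p - 1) / (p - 1)) * ennreal (g x powr p)" .
  qed
  also have "\<dots> = ennreal (2 * k * p * 2 powr (p - 1) / (p - 1)) * (\<integral>\<^sup>+x. ennreal (g x powr p) \<partial>lborel)"
    by (rule nn_integral_cmult) measurable
  finally show ?thesis
    by (simp only: h_def k_def)
qed

section \<open>Left-continuity in the radius and measurability\<close>

text \<open>A bridge from integrals against \<open>lebesgue\<close> to the Borel functions that
  \<open>HL\<close> and Tonelli require. The absolute value makes the representative nonnegative
  also on the null set where it differs from \<open>h\<close>.\<close>

lemma lebesgue_nonneg_representative:
  fixes h :: "'a::euclidean_space \<Rightarrow> real"
  assumes "h \<in> borel_measurable lebesgue" "\<And>x. 0 \<le> h x"
  shows "\<exists>g\<in>borel_measurable borel. (\<forall>x. 0 \<le> g x) \<and> (AE x in lborel. h x = g x)"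
proof -
  obtain g where [measurable]: "g \<in> borel_measurable lborel" and ae: "AE x in lborel. h x = g x"
    using completion_ex_borel_measurable_real[OF assms(1)] by blast
  from ae have "AE x in lborel. h x = \<bar>g x\<bar>"
    by eventually_elim (metis abs_of_nonneg assms(2))
  moreover have "(\<lambda>x. \<bar>g x\<bar>) \<in> borel_measurable borel"
    by measurable
  ultimately show ?thesis
    by (intro bexI[of _ "\<lambda>x. \<bar>g x\<bar>"]) auto
qed

lemma ennreal_set_lebesgue_integral:
  assumes nonneg: "\<And>x. 0 \<le> h x" and int: "set_integrable lebesgue A h"
    and ae: "AE x in lborel. h x = g x"
  shows "ennreal (LINT v:A|lebesgue. h v) = (\<integral>\<^sup>+v\<in>A. ennreal (g v) \<partial>lborel)"
proof -
  have "ennreal (LINT v:A|lebesgue. h v) = (\<integral>\<^sup>+v. ennreal (indicator A v *\<^sub>R h v) \<partial>lebesgue)"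
    unfolding set_lebesgue_integral_def
    using int nonneg unfolding set_integrable_def by (intro nn_integral_eq_integral[symmetric]) auto
  also have "\<dots> = (\<integral>\<^sup>+v. ennreal (indicator A v *\<^sub>R h v) \<partial>lborel)"
    by (rule nn_integral_completion)
  also have "\<dots> = (\<integral>\<^sup>+v\<in>A. ennreal (g v) \<partial>lborel)"
    using ae by (intro nn_integral_cong_AE) (auto simp: indicator_def elim: eventually_mono)
  finally show ?thesis .
qed

lemma set_lebesgue_integral_nonneg:
  fixes h :: "'a \<Rightarrow> real"
  assumes "\<And>x. 0 \<le> h x"
  shows "0 \<le> (LINT v:A|M. h v)"
  unfolding set_lebesgue_integral_def using assms by (intro Bochner_Integration.integral_nonneg) simp

lemma borel_measurable_lint_hball:
  fixes h :: "'n::finite heis \<Rightarrow> real"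
  assumes "h \<in> borel_measurable lebesgue" "\<And>x. 0 \<le> h x"
    and int: "\<And>u. set_integrable lebesgue (hball u r) h"
  shows "(\<lambda>u. LINT v:hball u r|lebesgue. h v) \<in> borel_measurable borel"
proof -
  obtain g where [measurable]: "g \<in> borel_measurable borel" and ae: "AE x in lborel. h x = g x"
    using lebesgue_nonneg_representative[OF assms(1,2)] by blast
  have "(LINT v:hball u r|lebesgue. h v) = enn2real (\<integral>\<^sup>+v\<in>hball u r. ennreal (g v) \<partial>lborel)" for u
    by (simp add: set_lebesgue_integral_nonneg assms(2)
        flip: ennreal_set_lebesgue_integral[OF assms(2) int ae])
  then have "(\<lambda>u. LINT v:hball u r|lebesgue. h v)
      = (\<lambda>u. enn2real (\<integral>\<^sup>+v\<in>hball u r. ennreal (g v) \<partial>lborel))"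
    by (rule ext)
  also have "\<dots> \<in> borel_measurable borel"
    by measurable
  finally show ?thesis .
qed

lemma lint_hball_mono:
  fixes h :: "'n::finite heis \<Rightarrow> real"
  assumes "\<And>x. 0 \<le> h x" "r \<le> t" "set_integrable lebesgue (hball u t) h"
  shows "(LINT v:hball u r|lebesgue. h v) \<le> (LINT v:hball u t|lebesgue. h v)"
proof -
  have "set_integrable lebesgue (hball u r) h"
    by (rule set_integrable_subset[OF assms(3)]) (simp_all add: hball_mono assms)
  then show ?thesis
    using assms hball_mono[OF assms(2), of u] unfolding set_lebesgue_integral_def set_integrable_def
    by (intro integral_mono) (auto simp: indicator_def)
qed

text \<open>Balls are defined by a strict inequality, which survives for radii slightly below r,
  while points outside the ball stay outside. Hence the indicators converge at every point and
  dominated convergence applies; from the right, the boundary sphere would be gained.\<close>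

lemma lint_hball_left_continuous:
  fixes h :: "'n::finite heis \<Rightarrow> real"
  assumes int: "set_integrable lebesgue (hball u r) h"
    and q: "\<And>n. q n \<le> r" "q \<longlonglongrightarrow> r"
  shows "(\<lambda>n. LINT v:hball u (q n)|lebesgue. h v) \<longlonglongrightarrow> (LINT v:hball u r|lebesgue. h v)"
  unfolding set_lebesgue_integral_def
proof (rule integral_dominated_convergence[where w = "\<lambda>v. norm (indicator (hball u r) v *\<^sub>R h v)"])
  show "integrable lebesgue (\<lambda>v. norm (indicator (hball u r) v *\<^sub>R h v))"
    using int unfolding set_integrable_def by (rule integrable_norm)
  show "(\<lambda>v. indicator (hball u r) v *\<^sub>R h v) \<in> borel_measurable lebesgue"
    using int unfolding set_integrable_def by (rule borel_measurable_integrable)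
  show "(\<lambda>v. indicator (hball u (q n)) v *\<^sub>R h v) \<in> borel_measurable lebesgue" for n
  proof -
    have "set_integrable lebesgue (hball u (q n)) h"
      by (rule set_integrable_subset[OF int]) (simp_all add: hball_mono q)
    then show ?thesis
      unfolding set_integrable_def by (rule borel_measurable_integrable)
  qed
  show "AE v in lebesgue. norm (indicator (hball u (q n)) v *\<^sub>R h v) \<le> norm (indicator (hball u r) v *\<^sub>R h v)" for n
    using hball_mono[OF q(1), of u] by (intro AE_I2) (auto simp: indicator_def)
  show "AE v in lebesgue. (\<lambda>n. indicator (hball u (q n)) v *\<^sub>R h v) \<longlonglongrightarrow> indicator (hball u r) v *\<^sub>R h v"
  proof (rule AE_I2)
    fix v
    have "\<forall>\<^sub>F n in sequentially. v \<in> hball u (q n) \<longleftrightarrow> v \<in> hball u r"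
    proof (cases "v \<in> hball u r")
      case True
      then have "\<forall>\<^sub>F n in sequentially. hdist u v < q n"
        using order_tendstoD(1)[OF q(2)] by (simp add: mem_hball)
      then show ?thesis
        by eventually_elim (use True in \<open>simp add: mem_hball\<close>)
    next
      case False
      then show ?thesis
        using hball_mono[OF q(1), of u] by (intro always_eventually) auto
    qed
    then have "\<forall>\<^sub>F n in sequentially. indicator (hball u (q n)) v *\<^sub>R h v = indicator (hball u r) v *\<^sub>R h v"
      by eventually_elim (simp add: indicator_def)
    then show "(\<lambda>n. indicator (hball u (q n)) v *\<^sub>R h v) \<longlonglongrightarrow> indicator (hball u r) v *\<^sub>R h v"
      by (rule tendsto_eventually)
  qed
qed

lemma rational_sequence_from_below:
  fixes r :: real
  assumes "a < r"
  shows "\<exists>q :: nat \<Rightarrow> real. (\<forall>n. q n \<in> \<rat> \<and> a < q n \<and> q n \<le> r) \<and> q \<longlonglongrightarrow> r"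
proof -
  have "\<exists>x\<in>\<rat>. max a (r - inverse (real (Suc n))) < x \<and> x < r" for n
    using assms by (intro Rats_dense_in_real) simp
  then obtain q where q: "\<And>n. q n \<in> \<rat>" "\<And>n. max a (r - inverse (real (Suc n))) < q n" "\<And>n. q n < r"
    by metis
  have "q \<longlonglongrightarrow> r"
  proof (rule tendsto_sandwich)
    show "(\<lambda>n. r - inverse (real (Suc n))) \<longlonglongrightarrow> r"
      using tendsto_diff[OF tendsto_const LIMSEQ_inverse_real_of_nat, of r] by simp
    show "(\<lambda>_. r) \<longlonglongrightarrow> r"
      by simp
    show "\<forall>\<^sub>F n in sequentially. r - inverse (real (Suc n)) \<le> q n"
      using q(2) by (intro always_eventually allI) (meson less_imp_le max_less_iff_conj)
    show "\<forall>\<^sub>F n in sequentially. q n \<le> r"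
      using q(3) by (intro always_eventually allI less_imp_le)
  qed
  then show ?thesis
    using q by (intro exI[of _ q]) (auto intro: less_imp_le)
qed

lemma hvol_left_continuous:
  fixes u :: "'n::finite heis"
  assumes "\<And>n. 0 < q n" "0 < r" "q \<longlonglongrightarrow> r"
  shows "(\<lambda>n. hvol (hball u (q n))) \<longlonglongrightarrow> hvol (hball u r)"
  unfolding hvol_scale[OF assms(1)] hvol_scale[OF assms(2)]
  by (intro tendsto_intros assms(3))

text \<open>A supremum condition over the uncountable range of radii becomes a countable one: monotone
  left-continuous functions are lower semicontinuous, so limits of approximate rational solutions
  in a compact interval are exact solutions.\<close>

lemma measurable_ex_radius:
  fixes I :: "'a \<Rightarrow> real \<Rightarrow> real"
  assumes meas: "\<And>r. (\<lambda>u. I u r) \<in> borel_measurable M"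
    and mono: "\<And>u r t. r \<le> t \<Longrightarrow> I u r \<le> I u t"
    and cont: "\<And>u r q. (\<And>n. q n \<le> r) \<Longrightarrow> q \<longlonglongrightarrow> r \<Longrightarrow> (\<lambda>n. I u (q n)) \<longlonglongrightarrow> I u r"
    and a: "0 \<le> a"
  shows "{u \<in> space M. \<exists>r>a. r powr c * I u r \<le> 1} \<in> sets M"
proof -
  \<comment> \<open>\<open>n\<close> keeps the radii a definite distance above \<open>a\<close>,
    \<open>m\<close> bounds them from above, and \<open>k\<close> is the tolerance paid for testing
    rational radii only.\<close>
  define P where "P n m k u \<longleftrightarrow> (\<exists>q\<in>{q\<in>\<rat>. a + inverse (real (Suc n)) \<le> q \<and> q \<le> real m}.
      q powr c * I u q \<le> 1 + inverse (real (Suc k)))" for n m k u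
  have "(\<exists>r>a. r powr c * I u r \<le> 1) \<longleftrightarrow> (\<exists>n m. \<forall>k. P n m k u)" for u
  proof
    assume "\<exists>r>a. r powr c * I u r \<le> 1"
    then obtain r where r: "a < r" "r powr c * I u r \<le> 1"
      by blast
    obtain n where "inverse (real (Suc n)) < r - a"
      using reals_Archimedean[of "r - a"] r(1) by auto
    then have n: "a + inverse (real (Suc n)) < r"
      by simp
    obtain m :: nat where m: "r \<le> real m"
      using real_arch_simple by blast
    obtain q where q: "\<And>j. q j \<in> \<rat> \<and> a + inverse (real (Suc n)) < q j \<and> q j \<le> r" "q \<longlonglongrightarrow> r"
      using rational_sequence_from_below[OF n] by blast
    have "(\<lambda>j. q j powr c * I u (q j)) \<longlonglongrightarrow> r powr c * I u r"
      using q r(1) a by (intro tendsto_mult cont tendsto_powr) auto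
    have "P n m k u" for k
    proof -
      have "r powr c * I u r < 1 + inverse (real (Suc k))"
        using r(2) by (rule order_le_less_trans) simp
      then have "\<forall>\<^sub>F j in sequentially. q j powr c * I u (q j) < 1 + inverse (real (Suc k))"
        by (rule order_tendstoD(2)[rotated]) fact
      then obtain j where "q j powr c * I u (q j) < 1 + inverse (real (Suc k))"
        using eventually_happens by fastforce
      then show ?thesis
        unfolding P_def using q(1)[of j] m by (intro bexI[of _ "q j"]) auto
    qed
    then show "\<exists>n m. \<forall>k. P n m k u"
      by blast
  next
    assume "\<exists>n m. \<forall>k. P n m k u"
    then obtain n m where "\<And>k. P n m k u"
      by blast
    then obtain q where q: "\<And>k. q k \<in> {a + inverse (real (Suc n))..real m}"
      "\<And>k. q k powr c * I u (q k) \<le> 1 + inverse (real (Suc k))"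
      unfolding P_def by (metis (mono_tags, lifting) atLeastAtMost_iff mem_Collect_eq)
    obtain r \<sigma> where r: "r \<in> {a + inverse (real (Suc n))..real m}" and \<sigma>: "strict_mono \<sigma>" "(q \<circ> \<sigma>) \<longlonglongrightarrow> r"
      using compact_imp_seq_compact[OF compact_Icc, THEN seq_compactE] q(1) by metis
    have "0 < inverse (real (Suc n))"
      by simp
    then have ar: "a < r" and q0: "\<And>k. 0 < q k"
      using r q(1) a unfolding atLeastAtMost_iff by (linarith, metis add_nonneg_pos less_le_trans)
    \<comment> \<open>The subsequence may approach r from above, where left-continuity gives
      nothing. Monotonicity therefore bounds \<open>I u s\<close> for s < r first, and
      left-continuity is used only afterwards, to let s tend to r.\<close>
    have below: "I u s \<le> r powr (- c)" if s: "s < r" for s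
    proof (rule tendsto_lowerbound)
      show "(\<lambda>k. (1 + inverse (real (Suc (\<sigma> k)))) * (q \<circ> \<sigma>) k powr (- c)) \<longlonglongrightarrow> r powr (- c)"
      proof -
        have 1: "(\<lambda>k. inverse (real (Suc (\<sigma> k)))) \<longlonglongrightarrow> 0"
          using LIMSEQ_subseq_LIMSEQ[OF LIMSEQ_inverse_real_of_nat \<sigma>(1)] by (simp add: o_def)
        have 2: "(\<lambda>k. (q \<circ> \<sigma>) k powr (- c)) \<longlonglongrightarrow> r powr (- c)"
          using ar a by (intro tendsto_powr tendsto_const \<sigma>(2)) simp
        have "(\<lambda>k. (1 + inverse (real (Suc (\<sigma> k)))) * (q \<circ> \<sigma>) k powr (- c)) \<longlonglongrightarrow> (1 + 0) * r powr (- c)"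
          by (intro tendsto_mult tendsto_add tendsto_const 1 2)
        then show ?thesis
          by simp
      qed
      have "\<forall>\<^sub>F k in sequentially. s < (q \<circ> \<sigma>) k"
        using \<sigma>(2) s by (rule order_tendstoD)
      then show "\<forall>\<^sub>F k in sequentially. I u s \<le> (1 + inverse (real (Suc (\<sigma> k)))) * (q \<circ> \<sigma>) k powr (- c)"
      proof eventually_elim
        case (elim k)
        then have "I u s \<le> I u (q (\<sigma> k))"
          by (intro mono) simp
        also have "I u (q (\<sigma> k)) = q (\<sigma> k) powr c * I u (q (\<sigma> k)) * q (\<sigma> k) powr (- c)"
          using q0[of "\<sigma> k"] by (simp add: powr_minus)
        also have "\<dots> \<le> (1 + inverse (real (Suc (\<sigma> k)))) * q (\<sigma> k) powr (- c)"
          using q(2)[of "\<sigma> k"] by (rule mult_right_mono) simp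
        finally show ?case
          by simp
      qed
    qed simp
    have "I u r \<le> r powr (- c)"
    proof (rule LIMSEQ_le_const2)
      have "(\<lambda>k. r - inverse (real (Suc k))) \<longlonglongrightarrow> r"
        using tendsto_diff[OF tendsto_const LIMSEQ_inverse_real_of_nat, of r] by simp
      then show "(\<lambda>k. I u (r - inverse (real (Suc k)))) \<longlonglongrightarrow> I u r"
        by (intro cont) simp_all
      show "\<exists>N. \<forall>k\<ge>N. I u (r - inverse (real (Suc k))) \<le> r powr (- c)"
        using below by simp
    qed
    then have "r powr c * I u r \<le> 1"
      using ar a by (simp add: powr_minus field_simps)
    then show "\<exists>r>a. r powr c * I u r \<le> 1"
      using ar by blast
  qed
  then have "{u \<in> space M. \<exists>r>a. r powr c * I u r \<le> 1} = {u \<in> space M. \<exists>n m. \<forall>k. P n m k u}"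
    by simp
  also have "\<dots> \<in> sets M"
  proof -
    have countable: "countable {q\<in>\<rat>. a + inverse (real (Suc n)) \<le> q \<and> q \<le> real m}" for n m
      by (rule countable_subset[OF _ countable_rat]) blast
    note [measurable] = meas
    have [measurable]: "Measurable.pred M (P n m k)" for n m k
      unfolding P_def pred_def by (intro sets.sets_Collect_countable_Ex' countable) measurable
    show ?thesis
      by measurable
  qed
  finally show ?thesis .
qed

text \<open>The real supremum of an empty or unbounded set is an unspecified constant, which suffices here.\<close>

lemma borel_measurable_Sup_radii:
  fixes T :: "'a \<Rightarrow> real set"
  assumes meas: "\<And>a. 0 \<le> a \<Longrightarrow> {u \<in> space M. \<exists>r\<in>T u. a < r} \<in> sets M"
    and pos: "\<And>u r. r \<in> T u \<Longrightarrow> 0 < r"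
  shows "(\<lambda>u. Sup (T u)) \<in> borel_measurable M"
proof (rule borel_measurableI_greater)
  fix a :: real
  define E where "E b = {u \<in> space M. \<exists>r\<in>T u. b < r}" for b
  have [measurable]: "E b \<in> sets M" if "0 \<le> b" for b
    using meas[OF that] by (simp add: E_def)
  have Sup_unbounded: "Sup X = (LEAST z :: real. False)" if "\<not> bdd_above X" for X :: "real set"
    using that unfolding Sup_real_def bdd_above_def by meson
  \<comment> \<open>Unboundedness becomes a countable condition, since natural thresholds
    suffice.\<close>
  have U: "u \<in> (\<Inter>n :: nat. E (real n)) \<longleftrightarrow> \<not> bdd_above (T u)" if "u \<in> space M" for u
  proof
    assume *: "u \<in> (\<Inter>n :: nat. E (real n))"
    show "\<not> bdd_above (T u)"
    proof
      assume "bdd_above (T u)"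
      then obtain b where b: "\<And>r. r \<in> T u \<Longrightarrow> r \<le> b"
        by (auto simp: bdd_above_def)
      obtain n :: nat where n: "b \<le> real n"
        using real_arch_simple by blast
      obtain r where "r \<in> T u" "real n < r"
        using * by (auto simp: E_def)
      then show False
        using b[of r] n by simp
    qed
  next
    assume "\<not> bdd_above (T u)"
    then show "u \<in> (\<Inter>n :: nat. E (real n))"
      using that unfolding E_def bdd_above_def by (auto simp: not_le)
  qed
  have E0: "u \<in> E 0 \<longleftrightarrow> T u \<noteq> {}" if "u \<in> space M" for u
    using that pos by (auto simp: E_def)
  \<comment> \<open>All radii are positive, so a negative threshold can be raised to 0, where
    \<open>meas\<close> is available.\<close>
  have "a < Sup (T u) \<longleftrightarrow> u \<in> E (max a 0)" if "u \<in> space M" "bdd_above (T u)" "T u \<noteq> {}" for u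
    using that pos unfolding less_cSup_iff[OF that(3,2)] E_def by fastforce
  then have "a < Sup (T u) \<longleftrightarrow> (if u \<in> (\<Inter>n :: nat. E (real n)) then a < (LEAST z :: real. False)
      else if u \<in> E 0 then u \<in> E (max a 0) else a < Sup {})" if "u \<in> space M" for u
    using that U[OF that] E0[OF that] Sup_unbounded by auto
  then have "{u \<in> space M. a < Sup (T u)} = {u \<in> space M. if u \<in> (\<Inter>n :: nat. E (real n)) then a < (LEAST z :: real. False)
      else if u \<in> E 0 then u \<in> E (max a 0) else a < Sup {}}"
    by blast
  also have "\<dots> \<in> sets M"
    by measurable
  finally show "{u \<in> space M. a < Sup (T u)} \<in> sets M" .
qed

section \<open>Measurability and positivity of the critical radius\<close>

lemma loc_integrable_borel_measurable:
  fixes V :: "'n::finite heis \<Rightarrow> real"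
  assumes "loc_integrable V"
  shows "V \<in> borel_measurable lebesgue"
proof (rule borel_measurable_LIMSEQ_real)
  show "(\<lambda>v. indicator (hball 0 (real n)) v *\<^sub>R V v) \<in> borel_measurable lebesgue" for n
    using assms borel_measurable_integrable unfolding loc_integrable_def set_integrable_def by blast
  fix v :: "'n heis"
  have "\<forall>\<^sub>F n in sequentially. hdist 0 v < real n"
    by (rule filterlim_at_top_dense[THEN iffD1, OF filterlim_real_sequentially, rule_format])
  then have "\<forall>\<^sub>F n in sequentially. indicator (hball 0 (real n)) v *\<^sub>R V v = V v"
    by eventually_elim (simp add: mem_hball)
  then show "(\<lambda>n. indicator (hball 0 (real n)) v *\<^sub>R V v) \<longlonglongrightarrow> V v"
    by (rule tendsto_eventually)
qed

text \<open>The weight of the maximal operator varies with its centre through the critical radius,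
  so measurability of \<open>Mrho\<close> rests on this.\<close>

lemma borel_measurable_crit_rad:
  fixes V :: "'n::finite heis \<Rightarrow> real"
  assumes nonneg: "\<And>x. 0 \<le> V x" and loc: "loc_integrable V"
  shows "crit_rad V \<in> borel_measurable borel"
proof -
  have int: "set_integrable lebesgue (hball u r) V" for u r
    using loc unfolding loc_integrable_def by blast
  have "(\<lambda>u. Sup {r. 0 < r \<and> r powr (2 - Qdim TYPE('n)) * (LINT v:hball u r|lebesgue. V v) \<le> 1})
      \<in> borel_measurable borel"
  proof (rule borel_measurable_Sup_radii)
    fix a :: real assume a: "0 \<le> a"
    have "{u \<in> space borel. \<exists>r>a. r powr (2 - Qdim TYPE('n)) * (LINT v:hball u r|lebesgue. V v) \<le> 1} \<in> sets borel"
      using a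
    proof (rule measurable_ex_radius[rotated 3])
      show "(\<lambda>u. LINT v:hball u r|lebesgue. V v) \<in> borel_measurable borel" for r
        by (intro borel_measurable_lint_hball loc_integrable_borel_measurable loc nonneg int)
      show "(LINT v:hball u r|lebesgue. V v) \<le> (LINT v:hball u t|lebesgue. V v)" if "r \<le> t" for u r t
        by (intro lint_hball_mono nonneg that int)
      show "(\<lambda>n. LINT v:hball u (q n)|lebesgue. V v) \<longlonglongrightarrow> (LINT v:hball u r|lebesgue. V v)"
        if "\<And>n. q n \<le> r" "q \<longlonglongrightarrow> r" for u r q
        by (intro lint_hball_left_continuous int that)
    qed
    moreover have "(\<exists>r\<in>{r. 0 < r \<and> F r}. a < r) \<longleftrightarrow> (\<exists>r>a. F r)" for F
      using a by (auto intro: order_le_less_trans)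
    ultimately show "{u \<in> space borel. \<exists>r\<in>{r. 0 < r \<and> r powr (2 - Qdim TYPE('n)) *
        (LINT v:hball u r|lebesgue. V v) \<le> 1}. a < r} \<in> sets borel"
      by simp
  qed simp
  then show ?thesis
    by (simp only: crit_rad_def[abs_def])
qed

text \<open>The lower bound rules out the value 0. If the radius at u were negative, both bounds would
  degenerate to 0 at points v with distance minus that radius from u.\<close>

lemma comparable_radius_pos:
  fixes \<rho> :: "'n::finite heis \<Rightarrow> real"
  assumes c: "1 \<le> c"
    and lower: "\<And>u v. (1 / c) * (1 + hdist v u / \<rho> u) powr (- a) \<le> \<rho> v / \<rho> u"
    and upper: "\<And>u v. \<rho> v / \<rho> u \<le> c * (1 + hdist v u / \<rho> u) powr b"
  shows "0 < \<rho> u"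
proof -
  \<comment> \<open>For a radius equal to 0 the lower bound with both points equal reads 1/c <= 0,
    as division by 0 yields 0.\<close>
  have nz: "\<rho> v \<noteq> 0" for v
    using lower[of v v] c by auto
  have "\<not> \<rho> u < 0"
  proof
    assume neg: "\<rho> u < 0"
    then obtain v where v: "hdist v u = - \<rho> u"
      using hdist_surj[of "- \<rho> u" u] by auto
    \<comment> \<open>At this distance the common base of the two powers is 1 - 1 = 0, and
      \<open>0 powr x\<close> is 0 for every x.\<close>
    have "\<rho> v / \<rho> u = 0"
      using lower[of v u] upper[of v u] v neg by simp
    then show False
      using nz[of u] nz[of v] by simp
  qed
  then show ?thesis
    using nz[of u] by linarith
qed

text \<open>Jensen's inequality up to a factor 2, from the pointwise bound t <= b + b^(1-p) t^p:
  either t <= b, or (t/b)^(p-1) >= 1. With b = a both terms integrate to at most a times the measure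
  of \<open>A\<close>. The same bound with b = 1 gives integrability.\<close>

lemma lint_le_of_lint_powr_le:
  fixes h :: "'a \<Rightarrow> real"
  assumes [measurable]: "h \<in> borel_measurable M" "A \<in> sets M" and nonneg: "\<And>x. 0 \<le> h x" and p: "1 \<le> p"
    and int: "set_integrable M A (\<lambda>x. h x powr p)" and fin: "emeasure M A < \<infinity>"
  shows "set_integrable M A h"
    and "0 \<le> a \<Longrightarrow> (LINT x:A|M. h x powr p) \<le> a powr p * measure M A \<Longrightarrow> (LINT x:A|M. h x) \<le> 2 * a * measure M A"
proof -
  have young: "t \<le> b + b powr (1 - p) * t powr p" if "0 \<le> t" "0 < b" for t b :: real
  proof (cases "t \<le> b")
    case True
    then show ?thesis
      by (simp add: add_increasing2)
  next
    case False
    then have "t = t powr (1 - p) * t powr p"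
      using that by (simp flip: powr_add)
    also have "\<dots> \<le> b powr (1 - p) * t powr p"
      using False that p by (intro mult_right_mono powr_mono2') auto
    finally show ?thesis
      using that by simp
  qed
  have const: "set_integrable M A (\<lambda>_. b)" for b :: real
    using fin unfolding set_integrable_def
    by (simp add: integrable_mult_left integrable_real_indicator mult.commute)
  have major: "set_integrable M A (\<lambda>x. b + b powr (1 - p) * h x powr p)" for b
    by (intro set_integral_add const set_integrable_mult_right int)
  show int1: "set_integrable M A h"
  proof (rule set_integrable_bound[OF major[of 1]])
    show "set_borel_measurable M A h"
      unfolding set_borel_measurable_def by measurable
    show "AE x in M. x \<in> A \<longrightarrow> norm (h x) \<le> norm (1 + 1 powr (1 - p) * h x powr p)"
      using young[of "h _" 1] nonneg by (intro AE_I2) (simp add: abs_of_nonneg add_nonneg_nonneg)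
  qed
  assume a: "0 \<le> a" and le: "(LINT x:A|M. h x powr p) \<le> a powr p * measure M A"
  \<comment> \<open>The pointwise inequality needs b > 0, so the bound is proved for all positive b
    >= a; the case a = 0 follows by letting b tend to 0.\<close>
  have bound: "(LINT x:A|M. h x) \<le> 2 * b * measure M A" if b: "0 < b" "a \<le> b" for b
  proof -
    have "(LINT x:A|M. h x) \<le> (LINT x:A|M. b + b powr (1 - p) * h x powr p)"
      using young nonneg b by (intro set_integral_mono int1 major) simp
    also have "\<dots> = b * measure M A + b powr (1 - p) * (LINT x:A|M. h x powr p)"
    proof -
      have "(LINT x:A|M. b) = b * measure M A"
        by (simp add: set_lebesgue_integral_def mult.commute)
      then show ?thesis
        by (subst set_integral_add(2)[OF const set_integrable_mult_right[OF int]]) simp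
    qed
    also have "\<dots> \<le> b * measure M A + b powr (1 - p) * (b powr p * measure M A)"
    proof -
      have "a powr p * measure M A \<le> b powr p * measure M A"
        using a b p by (intro mult_right_mono powr_mono2) simp_all
      with le show ?thesis
        by (intro add_left_mono mult_left_mono) simp_all
    qed
    also have "\<dots> = 2 * b * measure M A"
      using b by (simp flip: mult.assoc powr_add)
    finally show ?thesis .
  qed
  show "(LINT x:A|M. h x) \<le> 2 * a * measure M A"
  proof (cases "a = 0")
    case True
    have "((\<lambda>b. 2 * b * measure M A) \<longlongrightarrow> 2 * 0 * measure M A) (at_right 0)"
      by (intro tendsto_intros)
    moreover have "\<forall>\<^sub>F b in at_right 0. (LINT x:A|M. h x) \<le> 2 * b * measure M A"
      using bound True by (auto simp: eventually_at_filter)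
    ultimately show ?thesis
      using True tendsto_lowerbound[OF _ _ trivial_limit_at_right_real] by fastforce
  next
    case False
    then show ?thesis
      using bound[of a] a by simp
  qed
qed

text \<open>Clearing roots and weights turns a Morrey bound into a bound on the integral of the p-th
  power, a form in which near and far contributions can be added.\<close>

lemma morrey_quotient_le_iff:
  fixes b w p X K :: real
  assumes "0 < b" "0 < w" "0 < p" "0 \<le> X" "0 \<le> K"
  shows "w powr (- \<theta>) * (b powr (- \<kappa>) * X) powr (1 / p) \<le> K \<longleftrightarrow> X \<le> K powr p * w powr (\<theta> * p) * b powr \<kappa>"
proof -
  have "w powr (- \<theta>) * (b powr (- \<kappa>) * X) powr (1 / p) \<le> K \<longleftrightarrow> (b powr (- \<kappa>) * X) powr (1 / p) \<le> K * w powr \<theta>"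
    using assms by (simp add: powr_minus field_simps)
  also have "\<dots> \<longleftrightarrow> ((b powr (- \<kappa>) * X) powr (1 / p)) powr p \<le> (K * w powr \<theta>) powr p"
    using assms powr_mono2[of p "(b powr (- \<kappa>) * X) powr (1 / p)" "K * w powr \<theta>"]
      powr_less_mono2[of p "K * w powr \<theta>" "(b powr (- \<kappa>) * X) powr (1 / p)"]
    by fastforce
  also have "((b powr (- \<kappa>) * X) powr (1 / p)) powr p = b powr (- \<kappa>) * X"
    using assms by (simp add: powr_powr)
  also have "(K * w powr \<theta>) powr p = K powr p * w powr (\<theta> * p)"
    using assms by (simp add: powr_mult powr_powr)
  also have "b powr (- \<kappa>) * X \<le> K powr p * w powr (\<theta> * p) \<longleftrightarrow> X \<le> K powr p * w powr (\<theta> * p) * b powr \<kappa>"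
    using assms by (simp add: powr_minus field_simps)
  finally show ?thesis .
qed

section \<open>The weighted maximal operator on Morrey balls\<close>

definition Mavg :: "('n::finite heis \<Rightarrow> real) \<Rightarrow> nat \<Rightarrow> ('n heis \<Rightarrow> real) \<Rightarrow> 'n heis \<Rightarrow> real \<Rightarrow> real" where
  "Mavg V N f u r = (1 + r / crit_rad V u) powr (- real N)
     * ((1 / hvol (hball u r)) * (LINT v:hball u r|lebesgue. \<bar>f v\<bar>))"

lemma Mavg_nonneg: "0 \<le> Mavg V N f u r"
  unfolding Mavg_def hvol_def
  by (intro mult_nonneg_nonneg divide_nonneg_nonneg powr_ge_zero zero_le_one measure_nonneg
      set_lebesgue_integral_nonneg abs_ge_zero)

text \<open>The weighted averages are left-continuous in the radius, so each real radius is a limit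
  of rational ones from below. The supremum becomes countable, and its radii match those of
  \<open>HL\<close>.\<close>

lemma Mrho_eq_rational_SUP:
  assumes \<rho>: "0 < crit_rad V u"
    and int: "\<And>r. set_integrable lebesgue (hball u r) (\<lambda>v. \<bar>f v\<bar>)"
  shows "Mrho V N f u = (SUP r\<in>{r\<in>\<rat>. 0 < r}. ereal (Mavg V N f u r))"
proof (rule antisym)
  show "Mrho V N f u \<le> (SUP r\<in>{r\<in>\<rat>. 0 < r}. ereal (Mavg V N f u r))"
    unfolding Mrho_def Mavg_def[symmetric]
  proof (rule SUP_least)
    fix r :: real assume "r \<in> {0<..}"
    then have r: "0 < r"
      by simp
    then obtain q where q: "\<And>n. q n \<in> \<rat> \<and> 0 < q n \<and> q n \<le> r" "q \<longlonglongrightarrow> r"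
      using rational_sequence_from_below by blast
    have "(\<lambda>n. Mavg V N f u (q n)) \<longlonglongrightarrow> Mavg V N f u r"
      unfolding Mavg_def
    proof (intro tendsto_mult tendsto_divide tendsto_powr tendsto_add tendsto_const q(2))
      show "(\<lambda>n. hvol (hball u (q n))) \<longlonglongrightarrow> hvol (hball u r)"
        using q r by (intro hvol_left_continuous) auto
      show "(\<lambda>n. LINT v:hball u (q n)|lebesgue. \<bar>f v\<bar>) \<longlonglongrightarrow> (LINT v:hball u r|lebesgue. \<bar>f v\<bar>)"
        using q by (intro lint_hball_left_continuous int) auto
      show "hvol (hball u r) \<noteq> 0"
        using hvol_pos[OF r, of u] by simp
      have "0 < 1 + r / crit_rad V u"
        using r \<rho> by (simp add: add_pos_pos)
      then show "1 + r / crit_rad V u \<noteq> 0"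
        by simp
    qed (use \<rho> in simp)
    then have "(\<lambda>n. ereal (Mavg V N f u (q n))) \<longlonglongrightarrow> ereal (Mavg V N f u r)"
      by simp
    then show "ereal (Mavg V N f u r) \<le> (SUP r\<in>{r\<in>\<rat>. 0 < r}. ereal (Mavg V N f u r))"
    proof (rule LIMSEQ_le_const2)
      show "\<exists>m. \<forall>n\<ge>m. ereal (Mavg V N f u (q n)) \<le> (SUP r\<in>{r\<in>\<rat>. 0 < r}. ereal (Mavg V N f u r))"
        using q(1) by (intro exI[of _ 0] allI impI SUP_upper) simp
    qed
  qed
  show "(SUP r\<in>{r\<in>\<rat>. 0 < r}. ereal (Mavg V N f u r)) \<le> Mrho V N f u"
    unfolding Mrho_def Mavg_def[symmetric] by (rule SUP_subset_mono) auto
qed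

lemma Mrho_nonneg: "0 \<le> Mrho V N f u"
proof -
  have "ereal (Mavg V N f u 1) \<le> Mrho V N f u"
    unfolding Mrho_def Mavg_def[symmetric] by (rule SUP_upper) simp
  then show ?thesis
    using Mavg_nonneg[of V N f u 1] by (metis ereal_less_eq(5) order_trans)
qed

lemma borel_measurable_Mrho:
  fixes V :: "'n::finite heis \<Rightarrow> real"
  assumes [measurable]: "crit_rad V \<in> borel_measurable borel" and \<rho>: "\<And>u. 0 < crit_rad V u"
    and f: "f \<in> borel_measurable lebesgue"
    and int: "\<And>u r. set_integrable lebesgue (hball u r) (\<lambda>v. \<bar>f v\<bar>)"
  shows "Mrho V N f \<in> borel_measurable borel"
proof -
  have [measurable]: "(\<lambda>u. LINT v:hball u r|lebesgue. \<bar>f v\<bar>) \<in> borel_measurable borel" for r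
    using f by (intro borel_measurable_lint_hball int) simp_all
  have [measurable]: "(\<lambda>u :: 'n heis. hvol (hball u r)) \<in> borel_measurable borel" for r
    unfolding hvol_eq by measurable
  have "(\<lambda>u. SUP r\<in>{r\<in>\<rat>. 0 < r}. ereal (Mavg V N f u r)) \<in> borel_measurable borel"
    unfolding Mavg_def using countable_pos_rats by (intro borel_measurable_SUP) simp_all
  moreover have "Mrho V N f = (\<lambda>u. SUP r\<in>{r\<in>\<rat>. 0 < r}. ereal (Mavg V N f u r))"
    using Mrho_eq_rational_SUP[OF \<rho> int] by blast
  ultimately show ?thesis
    by simp
qed

lemma morrey_le_nonneg:
  assumes "morrey_le V p \<kappa> \<theta> K f"
  shows "0 \<le> K"
proof -
  define q where "q u r = (1 + r / crit_rad V u) powr (- \<theta>) *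
      (hvol (hball u r) powr (- \<kappa>) * (LINT v:hball u r|lebesgue. \<bar>f v\<bar> powr p)) powr (1 / p)" for u r
  have "0 \<le> q 0 1"
    unfolding q_def by (intro mult_nonneg_nonneg powr_ge_zero)
  also have "q 0 1 \<le> K"
  proof -
    have "\<forall>u r. 0 < r \<longrightarrow> set_integrable lebesgue (hball u r) (\<lambda>v. \<bar>f v\<bar> powr p) \<and> q u r \<le> K"
      using assms unfolding morrey_le_def q_def by (rule conjunct2)
    then show ?thesis
      using zero_less_one by blast
  qed
  finally show ?thesis .
qed

lemma morrey_le_abs_measurable:
  assumes "morrey_le V p \<kappa> \<theta> K f"
  shows "(\<lambda>v. \<bar>f v\<bar>) \<in> borel_measurable lebesgue"
proof -
  have "f \<in> borel_measurable lebesgue"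
    using assms unfolding morrey_le_def by blast
  then show ?thesis
    by (rule borel_measurable_abs)
qed

lemma morrey_le_lint_powr:
  assumes "morrey_le V p \<kappa> \<theta> K f" "0 < p" "0 < r" "0 < crit_rad V u"
  shows "(LINT v:hball u r|lebesgue. \<bar>f v\<bar> powr p)
    \<le> K powr p * (1 + r / crit_rad V u) powr (\<theta> * p) * hvol (hball u r) powr \<kappa>"
proof (subst morrey_quotient_le_iff[symmetric])
  show "(1 + r / crit_rad V u) powr (- \<theta>) *
      (hvol (hball u r) powr (- \<kappa>) * (LINT v:hball u r|lebesgue. \<bar>f v\<bar> powr p)) powr (1 / p) \<le> K"
    using assms(1,3) unfolding morrey_le_def by blast
  show "0 < 1 + r / crit_rad V u"
    using assms(3,4) by (simp add: add_pos_pos)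
qed (use assms hvol_pos[OF assms(3), of u] morrey_le_nonneg[OF assms(1)] in
    \<open>simp_all add: set_lebesgue_integral_nonneg\<close>)

lemma hball_lmeasurable: "hball u r \<in> sets lebesgue" "emeasure lebesgue (hball u r) < \<infinity>"
proof -
  have b: "hball u r \<in> sets lborel"
    unfolding sets_lborel by (rule hball_borel)
  then show "hball u r \<in> sets lebesgue"
    by (rule sets_completionI_sets)
  show "emeasure lebesgue (hball u r) < \<infinity>"
    using emeasure_hball_finite[of u r] b by simp
qed

lemma morrey_le_integrable:
  assumes m: "morrey_le V p \<kappa> \<theta> K f" and p: "1 \<le> p"
  shows "set_integrable lebesgue (hball u r) (\<lambda>v. \<bar>f v\<bar>)"
proof -
  note f = morrey_le_abs_measurable[OF m]
  \<comment> \<open>\<open>morrey_le\<close> speaks of positive radii only; enlarging the ball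
    covers the remaining values of \<open>r\<close>.\<close>
  have "set_integrable lebesgue (hball u (max r 1)) (\<lambda>v. \<bar>f v\<bar> powr p)"
  proof -
    have "0 < max r 1"
      by simp
    then show ?thesis
      using m unfolding morrey_le_def by blast
  qed
  then have "set_integrable lebesgue (hball u (max r 1)) (\<lambda>v. \<bar>f v\<bar>)"
    using p by (intro lint_le_of_lint_powr_le(1)[OF f hball_lmeasurable(1) _ _ _ hball_lmeasurable(2)]) simp_all
  then show ?thesis
    by (rule set_integrable_subset) (simp_all add: hball_mono hball_lmeasurable)
qed

lemma Mavg_far:
  fixes V :: "'n::finite heis \<Rightarrow> real" and u u0 :: "'n heis"
  assumes m: "morrey_le V p \<kappa> \<theta> K f" and p: "1 < p" and \<kappa>: "\<kappa> < 1" and \<theta>: "\<theta> \<le> real N"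
    and \<rho>: "0 < crit_rad V u" and r: "0 < r" "r \<le> t"
  shows "Mavg V N f u t \<le> 2 * K * hvol (hball u0 r) powr ((\<kappa> - 1) / p)"
proof -
  define w where "w = 1 + t / crit_rad V u"
  define b where "b = hvol (hball u t)"
  \<comment> \<open>Chosen so that \<open>a powr p * b\<close> is exactly the Morrey bound for the
    p-th power integral over B(u, t).\<close>
  define a where "a = K * w powr \<theta> * b powr ((\<kappa> - 1) / p)"
  have t: "0 < t"
    using r by linarith
  have w: "1 \<le> w"
    using t \<rho> by (simp add: w_def)
  have b: "0 < b"
    unfolding b_def by (rule hvol_pos[OF t])
  have K: "0 \<le> K"
    by (rule morrey_le_nonneg[OF m])
  have "(LINT v:hball u t|lebesgue. \<bar>f v\<bar>) \<le> 2 * a * measure lebesgue (hball u t)"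
  proof (rule lint_le_of_lint_powr_le(2)[where p = p])
    show "set_integrable lebesgue (hball u t) (\<lambda>v. \<bar>f v\<bar> powr p)"
      using m t unfolding morrey_le_def by blast
    have "a powr p = K powr p * w powr (\<theta> * p) * b powr (\<kappa> - 1)"
      using K w b p by (simp add: a_def powr_mult powr_powr)
    moreover have "b powr \<kappa> = b powr (\<kappa> - 1) * b"
      using b by (simp add: powr_diff)
    ultimately show "(LINT v:hball u t|lebesgue. \<bar>f v\<bar> powr p) \<le> a powr p * measure lebesgue (hball u t)"
      using morrey_le_lint_powr[OF m _ t \<rho>] p by (simp add: w_def b_def hvol_def mult.assoc)
    show "0 \<le> a"
      using K by (simp add: a_def)
  qed (use morrey_le_abs_measurable[OF m] p hball_lmeasurable[of u t] in simp_all)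
  then have "Mavg V N f u t \<le> w powr (- real N) * (1 / b * (2 * a * b))"
    using b unfolding Mavg_def w_def[symmetric] b_def[symmetric] hvol_def[of "hball u t", folded b_def, symmetric]
    by (intro mult_left_mono) simp_all
  also have "\<dots> = w powr (\<theta> - real N) * (2 * K * b powr ((\<kappa> - 1) / p))"
    using b w by (simp add: a_def powr_diff powr_minus field_simps)
  also have "\<dots> \<le> 1 * (2 * K * hvol (hball u0 r) powr ((\<kappa> - 1) / p))"
  proof (intro mult_mono)
    show "w powr (\<theta> - real N) \<le> 1"
      using powr_mono[of "\<theta> - real N" 0 w] w \<theta> by simp
    \<comment> \<open>The exponent is negative and the volume of a ball depends on its radius alone,
      so the ball around \<open>u\<close> can be compared with the smaller one around
      \<open>u0\<close>; the result is uniform in \<open>u\<close>.\<close>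
    show "b powr ((\<kappa> - 1) / p) \<le> hvol (hball u0 r) powr ((\<kappa> - 1) / p)"
      unfolding b_def using hvol_pos[OF r(1), of u0] hvol_mono[OF r, of u0 u] \<kappa> p
      by (intro powr_mono2') (simp_all add: divide_nonpos_pos)
  qed (use K in simp_all)
  finally show ?thesis
    by simp
qed

text \<open>The weight is at most 1 and is simply dropped. Cutting \<open>g\<close> off outside
  B(u0, 2r) changes nothing on B(u, t), and it hands the maximal theorem a function that is
  integrable on the whole space when \<open>g\<close> is locally integrable.\<close>

lemma Mavg_near:
  fixes V :: "'n::finite heis \<Rightarrow> real" and u u0 :: "'n heis"
  assumes int: "set_integrable lebesgue (hball u t) (\<lambda>v. \<bar>f v\<bar>)"
    and ae: "AE x in lborel. \<bar>f x\<bar> = g x" and \<rho>: "0 < crit_rad V u"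
    and u: "u \<in> hball u0 r" and t: "t \<in> \<rat>" "0 < t" "t \<le> r"
  shows "ennreal (Mavg V N f u t) \<le> HL (\<lambda>x. ennreal (g x * indicator (hball u0 (2 * r)) x)) u"
proof -
  let ?g = "\<lambda>x. ennreal (g x * indicator (hball u0 (2 * r)) x)"
  have sub: "hball u t \<subseteq> hball u0 (2 * r)"
    using u t by (intro hball_subset) (simp add: mem_hball)
  have "(1 + t / crit_rad V u) powr (- real N) \<le> 1"
    using t \<rho> powr_mono[of "- real N" 0 "1 + t / crit_rad V u"] by (simp split: if_splits)
  then have "Mavg V N f u t \<le> 1 * ((1 / hvol (hball u t)) * (LINT v:hball u t|lebesgue. \<bar>f v\<bar>))"
    unfolding Mavg_def using hvol_pos[OF t(2), of u]
    by (intro mult_right_mono) (simp_all add: set_lebesgue_integral_nonneg)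
  then have "ennreal (Mavg V N f u t) \<le> ennreal ((LINT v:hball u t|lebesgue. \<bar>f v\<bar>) / hvol (hball u t))"
    by (intro ennreal_leI) simp
  also have "\<dots> = ennreal (LINT v:hball u t|lebesgue. \<bar>f v\<bar>) / ennreal (hvol (hball u t))"
    using hvol_pos[OF t(2), of u] by (intro divide_ennreal[symmetric]) (simp_all add: set_lebesgue_integral_nonneg)
  also have "ennreal (LINT v:hball u t|lebesgue. \<bar>f v\<bar>) = (\<integral>\<^sup>+v\<in>hball u t. ?g v \<partial>lborel)"
  proof -
    have "(\<integral>\<^sup>+v\<in>hball u t. ennreal (g v) \<partial>lborel) = (\<integral>\<^sup>+v\<in>hball u t. ?g v \<partial>lborel)"
      using sub by (intro nn_integral_cong) (auto simp: indicator_def)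
    then show ?thesis
      using ennreal_set_lebesgue_integral[OF _ int ae] by simp
  qed
  also have "\<dots> / ennreal (hvol (hball u t)) = havg ?g u t"
    by (simp only: havg_def ennreal_hvol)
  also have "\<dots> \<le> HL ?g u"
    unfolding HL_def using t by (intro SUP_upper) simp
  finally show ?thesis .
qed

lemma Mrho_le_HL:
  fixes V :: "'n::finite heis \<Rightarrow> real" and u u0 :: "'n heis"
  assumes m: "morrey_le V p \<kappa> \<theta> K f" and p: "1 < p" and \<kappa>: "\<kappa> < 1" and \<theta>: "\<theta> \<le> real N"
    and ae: "AE x in lborel. \<bar>f x\<bar> = g x" and \<rho>: "0 < crit_rad V u"
    and u: "u \<in> hball u0 r" and r: "0 < r"
    and fin: "HL (\<lambda>x. ennreal (g x * indicator (hball u0 (2 * r)) x)) u < \<infinity>"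
  shows "Mrho V N f u \<le> ereal (max (enn2real (HL (\<lambda>x. ennreal (g x * indicator (hball u0 (2 * r)) x)) u))
    (2 * K * hvol (hball u0 r) powr ((\<kappa> - 1) / p)))"
proof -
  have int: "set_integrable lebesgue (hball u r) (\<lambda>v. \<bar>f v\<bar>)" for r
    using p by (intro morrey_le_integrable[OF m]) simp
  show ?thesis
    unfolding Mrho_eq_rational_SUP[OF \<rho> int]
  proof (rule SUP_least)
    fix t :: real assume t: "t \<in> {r \<in> \<rat>. 0 < r}"
    show "ereal (Mavg V N f u t) \<le> ereal (max (enn2real (HL (\<lambda>x. ennreal (g x * indicator (hball u0 (2 * r)) x)) u))
      (2 * K * hvol (hball u0 r) powr ((\<kappa> - 1) / p)))"
    proof (cases "t \<le> r")
      case True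
      then have "ennreal (Mavg V N f u t) \<le> HL (\<lambda>x. ennreal (g x * indicator (hball u0 (2 * r)) x)) u"
        using t by (intro Mavg_near[OF int ae \<rho> u]) simp_all
      from enn2real_mono[OF this] fin show ?thesis
        by (simp add: Mavg_nonneg le_max_iff_disj)
    next
      case False
      then have "Mavg V N f u t \<le> 2 * K * hvol (hball u0 r) powr ((\<kappa> - 1) / p)"
        using r by (intro Mavg_far[OF m p \<kappa> \<theta> \<rho>]) simp_all
      then show ?thesis
        by (simp add: le_max_iff_disj)
    qed
  qed
qed

text \<open>On B(u0, r) the maximal function is at most the maximum of the truncated
  \<open>HL\<close> and the far constant \<open>L\<close>. The strong type bound handles the first,
  and the second contributes L^p |B| = (2K)^p |B|^\<kappa>. The first conclusion ensures that
  \<open>real_of_ereal\<close> in \<open>F\<close> loses nothing outside a null set.\<close>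

lemma lint_Mrho_powr_le:
  fixes V :: "'n::finite heis \<Rightarrow> real" and u0 :: "'n heis" and f and N :: nat and p :: real
  defines "F \<equiv> \<lambda>u. real_of_ereal (Mrho V N f u)"
  defines "A \<equiv> 2 * 3 ^ hdim TYPE('n) * p * 2 powr (p - 1) / (p - 1)"
  assumes m: "morrey_le V p \<kappa> \<theta> K f" and p: "1 < p" and \<kappa>: "\<kappa> < 1" and \<theta>: "\<theta> \<le> real N"
    and meas: "crit_rad V \<in> borel_measurable borel" and \<rho>: "\<And>u. 0 < crit_rad V u" and r: "0 < r"
  shows "AE u in lebesgue. u \<in> hball u0 r \<longrightarrow> Mrho V N f u \<noteq> \<infinity>"
    and "set_integrable lebesgue (hball u0 r) (\<lambda>u. \<bar>F u\<bar> powr p)"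
    and "(LINT u:hball u0 r|lebesgue. \<bar>F u\<bar> powr p)
      \<le> A * (LINT v:hball u0 (2 * r)|lebesgue. \<bar>f v\<bar> powr p)
        + (2 * K) powr p * hvol (hball u0 r) powr \<kappa>"
proof -
  let ?B = "hball u0 r" and ?B2 = "hball u0 (2 * r)"
  define b where "b = hvol ?B"
  define L where "L = 2 * K * b powr ((\<kappa> - 1) / p)"
  have b: "0 < b"
    unfolding b_def by (rule hvol_pos[OF r])
  have K: "0 \<le> K"
    by (rule morrey_le_nonneg[OF m])
  have L: "0 \<le> L"
    using K by (simp add: L_def)
  have int: "set_integrable lebesgue (hball u t) (\<lambda>v. \<bar>f v\<bar>)" for u t
    using p by (intro morrey_le_integrable[OF m]) simp
  have intp: "set_integrable lebesgue ?B2 (\<lambda>v. \<bar>f v\<bar> powr p)"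
  proof -
    have "0 < 2 * r"
      using r by simp
    then show ?thesis
      using m unfolding morrey_le_def by blast
  qed
  obtain g where [measurable]: "g \<in> borel_measurable borel" and g: "\<And>x. 0 \<le> g x"
    and ae: "AE x in lborel. \<bar>f x\<bar> = g x"
    using lebesgue_nonneg_representative[OF morrey_le_abs_measurable[OF m]] by auto
  define g1 where "g1 x = g x * indicator ?B2 x" for x
  have [measurable]: "g1 \<in> borel_measurable borel"
    unfolding g1_def by measurable
  have g1: "0 \<le> g1 x" for x
    using g by (simp add: g1_def)
  have "f \<in> borel_measurable lebesgue"
    using m unfolding morrey_le_def by blast
  then have [measurable]: "Mrho V N f \<in> borel_measurable borel"
    by (intro borel_measurable_Mrho meas \<rho> int)
  have [measurable]: "F \<in> borel_measurable borel"
    unfolding F_def by measurable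
  have F: "0 \<le> F u" for u
    unfolding F_def by (rule real_of_ereal_pos[OF Mrho_nonneg])
  have "(\<integral>\<^sup>+x. ennreal (g1 x) \<partial>lborel) = (\<integral>\<^sup>+v\<in>?B2. ennreal (g v) \<partial>lborel)"
    by (intro nn_integral_cong) (auto simp: g1_def indicator_def)
  also have "\<dots> = ennreal (LINT v:?B2|lebesgue. \<bar>f v\<bar>)"
    by (rule ennreal_set_lebesgue_integral[OF abs_ge_zero int ae, symmetric])
  finally have fin: "AE u in lborel. HL (\<lambda>x. ennreal (g1 x)) u < \<infinity>"
    by (intro HL_finite_AE) simp_all
  have bound: "AE u in lborel. u \<in> ?B \<longrightarrow>
      Mrho V N f u \<le> ereal (max (enn2real (HL (\<lambda>x. ennreal (g1 x)) u)) L)"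
    using fin
  proof eventually_elim
    case (elim u)
    show ?case
    proof
      assume "u \<in> ?B"
      then show "Mrho V N f u \<le> ereal (max (enn2real (HL (\<lambda>x. ennreal (g1 x)) u)) L)"
        using Mrho_le_HL[OF m p \<kappa> \<theta> ae \<rho> _ r, of u u0] elim
        unfolding g1_def L_def b_def by blast
    qed
  qed
  from bound have "AE u in lborel. u \<in> ?B \<longrightarrow> Mrho V N f u \<noteq> \<infinity>"
    by eventually_elim (metis ereal_infty_less_eq(1) PInfty_neq_ereal(1))
  then show "AE u in lebesgue. u \<in> ?B \<longrightarrow> Mrho V N f u \<noteq> \<infinity>"
    by (rule AE_completion)
  from bound have Fle: "AE u in lborel. u \<in> ?B \<longrightarrow>
      F u powr p \<le> enn2real (HL (\<lambda>x. ennreal (g1 x)) u) powr p + L powr p"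
  proof eventually_elim
    case (elim u)
    show ?case
    proof
      let ?h = "enn2real (HL (\<lambda>x. ennreal (g1 x)) u)"
      assume "u \<in> ?B"
      then have "F u \<le> max ?h L"
        using elim real_of_ereal_positive_mono[OF Mrho_nonneg _ PInfty_neq_ereal(1),
            of V N f u "max ?h L"]
        unfolding F_def real_of_ereal.simps by blast
      then have "F u powr p \<le> (max ?h L) powr p"
        using F p by (intro powr_mono2) simp_all
      \<comment> \<open>One of the two summands is already the p-th power of the maximum, so no
        factor 2^p appears.\<close>
      also have "\<dots> \<le> ?h powr p + L powr p"
        by (simp add: max_def)
      finally show "F u powr p \<le> ?h powr p + L powr p" .
    qed
  qed
  define Y where "Y = (LINT v:?B2|lebesgue. \<bar>f v\<bar> powr p)"
  have Y: "0 \<le> Y"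
    unfolding Y_def by (intro set_lebesgue_integral_nonneg) simp
  have A: "0 \<le> A"
    using p by (simp add: A_def)
  have "(\<integral>\<^sup>+u\<in>?B. ennreal (F u powr p) \<partial>lborel)
      \<le> (\<integral>\<^sup>+u. ennreal (enn2real (HL (\<lambda>x. ennreal (g1 x)) u) powr p) + ennreal (L powr p) * indicator ?B u \<partial>lborel)"
    using Fle by (intro nn_integral_mono_AE)
      (auto simp: indicator_def simp flip: ennreal_plus elim!: eventually_mono intro: ennreal_leI)
  also have "\<dots> = (\<integral>\<^sup>+u. ennreal (enn2real (HL (\<lambda>x. ennreal (g1 x)) u) powr p) \<partial>lborel)
      + ennreal (L powr p) * emeasure lborel ?B"
    by (subst nn_integral_add) (simp_all add: nn_integral_cmult_indicator)
  also have "\<dots> \<le> ennreal A * (\<integral>\<^sup>+x. ennreal (g1 x powr p) \<partial>lborel) + ennreal (L powr p) * emeasure lborel ?B"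
    unfolding A_def by (intro add_right_mono HL_strong_type g1 p) simp
  also have "(\<integral>\<^sup>+x. ennreal (g1 x powr p) \<partial>lborel) = (\<integral>\<^sup>+v\<in>?B2. ennreal (g v powr p) \<partial>lborel)"
    by (intro nn_integral_cong) (auto simp: g1_def indicator_def)
  also have "\<dots> = ennreal Y"
  proof -
    have "AE x in lborel. \<bar>f x\<bar> powr p = g x powr p"
      using ae by eventually_elim simp
    from ennreal_set_lebesgue_integral[OF _ intp this] show ?thesis
      by (simp add: Y_def)
  qed
  also have "emeasure lborel ?B = ennreal b"
    by (simp add: b_def ennreal_hvol)
  also have "ennreal A * ennreal Y + ennreal (L powr p) * ennreal b = ennreal (A * Y + L powr p * b)"
    using A Y b by (simp add: ennreal_mult ennreal_plus)
  also have "L powr p * b = (2 * K) powr p * b powr \<kappa>"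
    using K b p powr_diff[of b \<kappa> 1] by (simp add: L_def powr_mult powr_powr)
  finally have le: "(\<integral>\<^sup>+u\<in>?B. ennreal (F u powr p) \<partial>lborel) \<le> ennreal (A * Y + (2 * K) powr p * b powr \<kappa>)" .
  show intF: "set_integrable lebesgue ?B (\<lambda>u. \<bar>F u\<bar> powr p)"
    unfolding set_integrable_def
  proof (rule integrableI_nonneg)
    have "(\<lambda>u. indicator ?B u *\<^sub>R \<bar>F u\<bar> powr p) \<in> borel_measurable lborel"
      by measurable
    then show "(\<lambda>u. indicator ?B u *\<^sub>R \<bar>F u\<bar> powr p) \<in> borel_measurable lebesgue"
      by (rule measurable_completion)
    have "(\<integral>\<^sup>+u. ennreal (indicator ?B u *\<^sub>R \<bar>F u\<bar> powr p) \<partial>lebesgue) = (\<integral>\<^sup>+u\<in>?B. ennreal (F u powr p) \<partial>lborel)"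
      unfolding nn_integral_completion using F by (intro nn_integral_cong) (auto simp: indicator_def)
    also have "\<dots> < \<infinity>"
      using le by (rule order_le_less_trans) simp
    finally show "(\<integral>\<^sup>+u. ennreal (indicator ?B u *\<^sub>R \<bar>F u\<bar> powr p) \<partial>lebesgue) < \<infinity>" .
  qed simp
  have "AE u in lborel. \<bar>F u\<bar> powr p = F u powr p"
    using F by (intro AE_I2) simp
  from ennreal_set_lebesgue_integral[OF _ intF this] le
  have "ennreal (LINT u:?B|lebesgue. \<bar>F u\<bar> powr p) \<le> ennreal (A * Y + (2 * K) powr p * b powr \<kappa>)"
    by simp
  then show "(LINT u:?B|lebesgue. \<bar>F u\<bar> powr p) \<le> A * Y + (2 * K) powr p * b powr \<kappa>"
    unfolding Y_def[symmetric] b_def[symmetric] using A Y by (subst (asm) ennreal_le_iff) simp_all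
qed

theorem theorem3p3:
  fixes V :: "'n::finite heis \<Rightarrow> real"
    and p \<kappa> s \<theta> N0 C0 :: real and N :: nat
  assumes "1 < p" and "0 < \<kappa>" and "\<kappa> < 1"
    and "\<forall>x. 0 \<le> V x" and "loc_integrable V"
    and "\<not> (AE x in lebesgue. V x = 0)"
    and "s \<ge> Qdim TYPE('n) / 2" and "RH s V"
    and "N0 > 0" and "C0 \<ge> 1"
    and "\<forall>u v. (1 / C0) * (1 + hnorm (hmul (hinv v) u) / crit_rad V u) powr (- N0)
                  \<le> crit_rad V v / crit_rad V u \<and>
               crit_rad V v / crit_rad V u
                  \<le> C0 * (1 + hnorm (hmul (hinv v) u) / crit_rad V u) powr (N0 / (N0 + 1))"
    and "0 < \<theta>" and "\<theta> * (N0 + 1) \<le> real N"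
  shows "\<exists>C. \<forall>f K. morrey_le V p \<kappa> \<theta> K f \<longrightarrow>
           (AE u in lebesgue. Mrho V N f u \<noteq> \<infinity>) \<and>
           morrey_le V p \<kappa> \<theta> (C * K) (\<lambda>u. real_of_ereal (Mrho V N f u))"
proof -
  define A where "A = 2 * 3 ^ hdim TYPE('n) * p * 2 powr (p - 1) / (p - 1)"
  \<comment> \<open>Doubling the radius for the near part costs 2^(\<theta> p) in the weight, since
    1 + 2x <= 2(1 + x), and (2^Q)^\<kappa> in the volume; \<open>A\<close> is the strong type
    constant. The last summand is the factor 2^p of the far part.\<close>
  define D where "D = A * 2 powr (\<theta> * p) * (2 ^ hdim TYPE('n)) powr \<kappa> + 2 powr p"
  define C where "C = D powr (1 / p)"
  have A: "0 \<le> A"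
    using assms(1) by (simp add: A_def)
  have D: "0 \<le> D"
    using A by (simp add: D_def)
  have Cp: "C powr p = D"
    using assms(1) D by (simp add: C_def powr_powr)
  have pos: "0 < crit_rad V u" for u
    using assms(10,11) by (intro comparable_radius_pos[where c = C0 and a = N0 and b = "N0 / (N0 + 1)"]) blast+
  have meas: "crit_rad V \<in> borel_measurable borel"
    using assms(4,5) by (intro borel_measurable_crit_rad) blast+
  have "\<theta> * 1 \<le> \<theta> * (N0 + 1)"
    using assms(9,12) by (intro mult_left_mono) simp_all
  then have \<theta>: "\<theta> \<le> real N"
    using assms(13) by simp
  have "(AE u in lebesgue. Mrho V N f u \<noteq> \<infinity>) \<and> morrey_le V p \<kappa> \<theta> (C * K) (\<lambda>u. real_of_ereal (Mrho V N f u))"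
    if m: "morrey_le V p \<kappa> \<theta> K f" for f K
  proof
    note ball = lint_Mrho_powr_le[OF m assms(1,3) \<theta> meas pos]
    have K: "0 \<le> K"
      by (rule morrey_le_nonneg[OF m])
    \<comment> \<open>Finiteness is known ball by ball, so countably many balls exhausting the group
      are used; \<open>Suc\<close> keeps their radii positive.\<close>
    have "AE u in lebesgue. \<forall>n. u \<in> hball 0 (real (Suc n)) \<longrightarrow> Mrho V N f u \<noteq> \<infinity>"
      unfolding AE_all_countable by (intro allI ball(1)) simp
    then show "AE u in lebesgue. Mrho V N f u \<noteq> \<infinity>"
    proof eventually_elim
      case (elim u)
      obtain n :: nat where "hdist 0 u < real n"
        using reals_Archimedean2 by blast
      then have "u \<in> hball 0 (real (Suc n))"
        by (simp add: mem_hball)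
      then show ?case
        using elim by blast
    qed
    have "f \<in> borel_measurable lebesgue"
      using m unfolding morrey_le_def by blast
    then have [measurable]: "Mrho V N f \<in> borel_measurable borel"
      using assms(1) by (intro borel_measurable_Mrho meas pos morrey_le_integrable[OF m]) simp_all
    have "(\<lambda>u. real_of_ereal (Mrho V N f u)) \<in> borel_measurable lborel"
      by measurable
    then have F: "(\<lambda>u. real_of_ereal (Mrho V N f u)) \<in> borel_measurable lebesgue"
      by (rule measurable_completion)
    show "morrey_le V p \<kappa> \<theta> (C * K) (\<lambda>u. real_of_ereal (Mrho V N f u))"
      unfolding morrey_le_def
    proof (intro conjI allI impI F)
      fix u0 :: "'n heis" and r :: real assume r: "0 < r"
      show "set_integrable lebesgue (hball u0 r) (\<lambda>v. \<bar>real_of_ereal (Mrho V N f v)\<bar> powr p)"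
        by (rule ball(2)[OF r])
      define b where "b = hvol (hball u0 r)"
      define w where "w = 1 + r / crit_rad V u0"
      have b: "0 < b"
        unfolding b_def by (rule hvol_pos[OF r])
      have w: "1 \<le> w"
        using r pos[of u0] by (simp add: w_def)
      have r2: "0 < 2 * r"
        using r by simp
      have b2: "hvol (hball u0 (2 * r)) = 2 ^ hdim TYPE('n) * b"
        unfolding b_def hvol_scale[OF r2] hvol_scale[OF r] power_mult_distrib by simp
      have "0 < r / crit_rad V u0"
        using r pos[of u0] by simp
      then have w2: "(1 + 2 * r / crit_rad V u0) powr (\<theta> * p) \<le> (2 * w) powr (\<theta> * p)"
        using assms(1,12) unfolding w_def by (intro powr_mono2) simp_all
      have "(LINT v:hball u0 (2 * r)|lebesgue. \<bar>f v\<bar> powr p)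
          \<le> K powr p * (1 + 2 * r / crit_rad V u0) powr (\<theta> * p) * (2 ^ hdim TYPE('n) * b) powr \<kappa>"
        using morrey_le_lint_powr[OF m _ r2 pos, of u0] assms(1) unfolding b2 by simp
      also have "\<dots> \<le> K powr p * (2 * w) powr (\<theta> * p) * (2 ^ hdim TYPE('n) * b) powr \<kappa>"
        by (intro mult_right_mono mult_left_mono w2) simp_all
      finally have "A * (LINT v:hball u0 (2 * r)|lebesgue. \<bar>f v\<bar> powr p)
          \<le> A * (K powr p * (2 * w) powr (\<theta> * p) * (2 ^ hdim TYPE('n) * b) powr \<kappa>)"
        by (rule mult_left_mono) (rule A)
      \<comment> \<open>The far part carries no weight of its own; as w >= 1, the weight can be
        inserted so that both parts share one factor.\<close>
      moreover have "(2 * K) powr p * b powr \<kappa> \<le> (2 * K) powr p * b powr \<kappa> * w powr (\<theta> * p)"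
        using w assms(1,12) ge_one_powr_ge_zero[of w "\<theta> * p"]
          mult_left_mono[of 1 "w powr (\<theta> * p)" "(2 * K) powr p * b powr \<kappa>"] by simp
      ultimately have "(LINT u:hball u0 r|lebesgue. \<bar>real_of_ereal (Mrho V N f u)\<bar> powr p)
          \<le> A * (K powr p * (2 * w) powr (\<theta> * p) * (2 ^ hdim TYPE('n) * b) powr \<kappa>)
            + (2 * K) powr p * b powr \<kappa> * w powr (\<theta> * p)"
        using ball(3)[OF r, of u0] unfolding A_def b_def by linarith
      also have "\<dots> = (C * K) powr p * w powr (\<theta> * p) * b powr \<kappa>"
        using w b K D Cp by (simp add: powr_mult D_def algebra_simps C_def[symmetric])
      finally show "(1 + r / crit_rad V u0) powr - \<theta> * (hvol (hball u0 r) powr - \<kappa> *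
          (LINT v:hball u0 r|lebesgue. \<bar>real_of_ereal (Mrho V N f v)\<bar> powr p)) powr (1 / p) \<le> C * K"
        unfolding b_def[symmetric] w_def[symmetric]
        using b w K assms(1)
        by (subst morrey_quotient_le_iff) (simp_all add: C_def set_lebesgue_integral_nonneg)
    qed
  qed
  then show ?thesis
    by blast
qed

end
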